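(* Let $\mathsf{A}=\{A_0,A_1\}$ be a pair of $2\times2$ real matrices which satisfies the technical hypotheses and the Sturmian hypothesis, with $1$-ratio function $\mathfrak{r}\colon[0,\infty)\to[0,1]$, and let $\gamma\in(0,1)\setminus\mathbb{Q}$. Let $(a_n)_{n=1}^\infty$ be the sequence of continued fraction coefficients of $\gamma$, and for each $n\ge1$ let $p_n/q_n$ be the corresponding convergent (in least terms); put also $q_0:=1$. Define finite words $s_n$ inductively by $s_{-1}:=1$, $s_0:=0$, $s_1:=s_0^{a_1-1}s_{-1}$ and $s_{n+1}:=s_n^{a_{n+1}}s_{n-1}$ for every $n\ge1$, and for each integer $n\ge-1$ define $\rho_n:=\rho(\mathcal{A}(s_n))$. Then $\mathfrak{r}^{-1}(\gamma)$ is the singleton set whose unique element is \[\alpha_\gamma:=\lim_{n\to\infty}\left(\frac{\rho_n^{q_{n+1}}}{\rho_{n+1}^{q_n}}\right)^{(-1)^n}=\frac{1}{\rho(A_1)}\prod_{n=0}^\infty\left(\frac{\rho_n^{a_{n+1}}\rho_{n-1}}{\rho_{n+1}}\right)^{(-1)^nq_n},\] where the infinite product is understood as the limit of its partial products.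
   Context: Continued fractions: $\gamma=[a_1,a_2,\ldots]=\cfrac{1}{a_1+\cfrac{1}{a_2+\cdots}}$ with positive integers $a_i$, and $p_n/q_n=[a_1,\ldots,a_n]$. Spectral radii. $\rho(B)$ is the spectral radius of a matrix $B$. For a finite set $\mathsf{B}$ of matrices, the joint spectral radius is $\varrho(\mathsf{B}):=\lim_{n\to\infty}\max\{\|B_{i_n}\cdots B_{i_1}\|^{1/n}: B_{i_j}\in\mathsf{B}\}$ (independent of the norm). Words. $\Sigma_2=\{0,1\}^{\mathbb{N}}$ is the set of infinite words $x=(x_i)_{i\ge1}$. For a finite word $u$ over $\{0,1\}$, $|u|$ is its length and $|u|_1$ the number of its entries equal to $1$. Concatenation is written $uv$, $u^k$ is the $k$-fold concatenation of $u$, and $u^0$ is the empty word. A finite word $u$ is balanced if $\big||v_1|_1-|v_2|_1\big|\le1$ for all pairs of (contiguous) subwords $v_1,v_2$ of $u$ with $|v_1|=|v_2|$; it is cyclically balanced if it and all of its cyclic permutations are balanced. Sturmian sets. For $\gamma\in[0,1]$, $X_\gamma\subset\Sigma_2$ is the set of all $x=(x_n)_{n\ge1}$ for which there is $\delta\in\mathbb{R}$ such that either $x_n=\lfloor\gamma(n+1)+\delta\rfloor-\lfloor\gamma n+\delta\rfloor$ for all $n$, or $x_n=\lceil\gamma(n+1)+\delta\rceil-\lceil\gamma n+\delta\rceil$ for all $n$. Matrix products. Given $\mathsf{A}=\{A_0,A_1\}$ and $\alpha\ge0$, put $A_0^{(\alpha)}:=A_0$, $A_1^{(\alpha)}:=\alpha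 A_1$, $\mathsf{A}_\alpha:=\{A_0^{(\alpha)},A_1^{(\alpha)}\}$, $\varrho(\alpha):=\varrho(\mathsf{A}_\alpha)$. For a finite word $u$ of length $m\ge1$, $\mathcal{A}_\alpha(u):=A_{u_m}^{(\alpha)}\cdots A_{u_1}^{(\alpha)}$ and $\mathcal{A}(u):=\mathcal{A}_1(u)$. For $x\in\Sigma_2$, $n\ge1$: $\mathcal{A}_\alpha(x,n):=A_{x_n}^{(\alpha)}\cdots A_{x_1}^{(\alpha)}$. A sequence $x\in\Sigma_2$ is weakly extremal for $\mathsf{A}_\alpha$ if $\|\mathcal{A}_\alpha(x,n)\|^{1/n}\to\varrho(\alpha)$. Technical hypotheses on $\mathsf{A}$: (1) $A_0,A_1$ are non-negative, invertible, have positive trace, and have no common invariant subspace (of dimension one); (2) if $u$ is a (nonempty) finite word not of the form $1^n$ or $0^n$, then all entries of $\mathcal{A}(u)$ are positive. Sturmian hypothesis on $\mathsf{A}$: there is a function $\mathfrak{r}\colon[0,\infty)\to[0,1]$ (necessarily unique, called the $1$-ratio function of $\mathsf{A}$) such that for every $\alpha\ge0$: (3) every $x\in X_{\mathfrak{r}(\alpha)}$ is weakly extremal for $\mathsf{A}_\alpha$; (4) if $x\in\Sigma_2$ is weakly extremal for $\mathsf{A}_\alpha$ then $n^{-1}\#\{1\le i\le n: x_i=1\}\to\mathfrak{r}(\alpha)$; (5) if $u$ is a finite word which is not cyclically balanced then $\rho(\mathcal{A}_\alpha(u))<\varrho(\alpha)^{|u|}$. *)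

theory Defs
  imports "HOL-Analysis.Analysis" "HOL-Library.Sublist"
begin

subsection \<open>Spectral radius and joint spectral radius\<close>

definition spectral_radius :: "real^'n^'n \<Rightarrow> real" where
  "spectral_radius B =
     Max (cmod ` {z. \<exists>v::complex^'n. v \<noteq> 0 \<and> map_matrix complex_of_real B *v v = z *s v})"

text \<open>The factors appear in reverse order: the list \<open>[B1, ..., Bn]\<close> is sent to \<open>Bn ** ... ** B1\<close>.\<close>

primrec rev_prod :: "(real^'n^'n) list \<Rightarrow> real^'n^'n" where
  "rev_prod [] = mat 1"
| "rev_prod (M # Ms) = rev_prod Ms ** M"

text \<open>The library norm on \<^typ>\<open>real^'n^'n\<close> is the Frobenius norm; the limit does not
  depend on the choice of the norm.\<close>

definition joint_spectral_radius :: "(real^'n^'n) set \<Rightarrow> real" where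
  "joint_spectral_radius \<B> =
     lim (\<lambda>n. Max {root n (norm (rev_prod Bs)) | Bs. length Bs = n \<and> set Bs \<subseteq> \<B>})"

subsection \<open>Words\<close>

text \<open>The letters \<open>0\<close> and \<open>1\<close> are \<^term>\<open>False\<close> and \<^term>\<open>True\<close>. An infinite word
  \<open>(x_n)\<close>, \<open>n \<ge> 1\<close>, is a function \<open>x\<close> on \<^typ>\<open>nat\<close> with \<open>x_n = x (n - 1)\<close>.\<close>

type_synonym word = "bool list"

definition word_power :: "word \<Rightarrow> nat \<Rightarrow> word" where
  "word_power u k = concat (replicate k u)"

definition balanced :: "word \<Rightarrow> bool" where
  "balanced u \<longleftrightarrow> (\<forall>v1 v2. sublist v1 u \<and> sublist v2 u \<and> length v1 = length v2 \<longrightarrow>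
     \<bar>int (count_list v1 True) - int (count_list v2 True)\<bar> \<le> 1)"

definition cyclically_balanced :: "word \<Rightarrow> bool" where
  "cyclically_balanced u \<longleftrightarrow> (\<forall>k. balanced (rotate k u))"

definition sturmian_set :: "real \<Rightarrow> (nat \<Rightarrow> bool) set" where
  "sturmian_set \<gamma> = {x. \<exists>\<delta>::real.
     (\<forall>n\<ge>1. of_bool (x (n - 1)) = \<lfloor>\<gamma> * real (n + 1) + \<delta>\<rfloor> - \<lfloor>\<gamma> * real n + \<delta>\<rfloor>) \<or>
     (\<forall>n\<ge>1. of_bool (x (n - 1)) = \<lceil>\<gamma> * real (n + 1) + \<delta>\<rceil> - \<lceil>\<gamma> * real n + \<delta>\<rceil>)}"

subsection \<open>Products of a weighted pair of matrices\<close>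

definition letter_matrix :: "real^2^2 \<Rightarrow> real^2^2 \<Rightarrow> real \<Rightarrow> bool \<Rightarrow> real^2^2" where
  "letter_matrix A0 A1 \<alpha> b = (if b then \<alpha> *\<^sub>R A1 else A0)"

definition word_matrix :: "real^2^2 \<Rightarrow> real^2^2 \<Rightarrow> real \<Rightarrow> word \<Rightarrow> real^2^2" where
  "word_matrix A0 A1 \<alpha> u = rev_prod (map (letter_matrix A0 A1 \<alpha>) u)"

definition pair_jsr :: "real^2^2 \<Rightarrow> real^2^2 \<Rightarrow> real \<Rightarrow> real" where
  "pair_jsr A0 A1 \<alpha> = joint_spectral_radius {A0, \<alpha> *\<^sub>R A1}"

definition weakly_extremal :: "real^2^2 \<Rightarrow> real^2^2 \<Rightarrow> real \<Rightarrow> (nat \<Rightarrow> bool) \<Rightarrow> bool" where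
  "weakly_extremal A0 A1 \<alpha> x \<longleftrightarrow>
     (\<lambda>n. root n (norm (word_matrix A0 A1 \<alpha> (map x [0..<n])))) \<longlonglongrightarrow> pair_jsr A0 A1 \<alpha>"

subsection \<open>The hypotheses on the pair of matrices\<close>

definition technical_hypotheses :: "real^2^2 \<Rightarrow> real^2^2 \<Rightarrow> bool" where
  "technical_hypotheses A0 A1 \<longleftrightarrow>
     (\<forall>A\<in>{A0, A1}. (\<forall>i j. 0 \<le> A $ i $ j) \<and> invertible A \<and> 0 < trace A) \<and>
     \<not> (\<exists>V. subspace V \<and> dim V = 1 \<and> (\<forall>A\<in>{A0, A1}. \<forall>v\<in>V. A *v v \<in> V)) \<and>
     (\<forall>u. u \<noteq> [] \<and> (\<nexists>n. u = replicate n True) \<and> (\<nexists>n. u = replicate n False) \<longrightarrow>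
        (\<forall>i j. 0 < word_matrix A0 A1 1 u $ i $ j))"

text \<open>The Sturmian hypothesis, with \<open>r\<close> as the 1-ratio function; the values of \<open>r\<close> outside
  \<open>{0..}\<close> are irrelevant.\<close>

definition sturmian_hypothesis :: "real^2^2 \<Rightarrow> real^2^2 \<Rightarrow> (real \<Rightarrow> real) \<Rightarrow> bool" where
  "sturmian_hypothesis A0 A1 r \<longleftrightarrow> r \<in> {0..} \<rightarrow> {0..1} \<and>
     (\<forall>\<alpha>\<ge>0.
        (\<forall>x\<in>sturmian_set (r \<alpha>). weakly_extremal A0 A1 \<alpha> x) \<and>
        (\<forall>x. weakly_extremal A0 A1 \<alpha> x \<longrightarrow>
           (\<lambda>n. real (card {i\<in>{1..n}. x (i - 1)}) / real n) \<longlonglongrightarrow> r \<alpha>) \<and>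
        (\<forall>u. \<not> cyclically_balanced u \<longrightarrow>
           spectral_radius (word_matrix A0 A1 \<alpha> u) < pair_jsr A0 A1 \<alpha> ^ length u))"

subsection \<open>Continued fractions\<close>

primrec cont_frac :: "nat list \<Rightarrow> real" where
  "cont_frac [] = 0"
| "cont_frac (a # as) = 1 / (real a + cont_frac as)"

text \<open>\<open>a 0\<close> is not used: the coefficients are \<open>a 1, a 2, ...\<close>.\<close>

definition cont_frac_coefficients :: "real \<Rightarrow> (nat \<Rightarrow> nat) \<Rightarrow> bool" where
  "cont_frac_coefficients \<gamma> a \<longleftrightarrow>
     (\<forall>n\<ge>1. 0 < a n) \<and> (\<lambda>n. cont_frac (map a [1..<n + 1])) \<longlonglongrightarrow> \<gamma>"

end

theory Submission
  imports Defs
begin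

text \<open>Write \<open>M n\<close> for the matrix of \<open>s_n\<close>. Positive matrices contract Hilbert's metric, so the Perron
  vectors of the \<open>M n\<close> converge so fast that
  \<open>e_n = ln \<rho>_(n+2) - a_(n+2) ln \<rho>_(n+1) - ln \<rho>_n\<close> is exponentially small in \<open>q_(n+1)\<close>. As
  \<open>E_n = (-1)^n (q_n ln \<rho>_(n+1) - q_(n+1) ln \<rho>_n)\<close> has increments \<open>\<plusminus>q_(n+1) e_n\<close>, it converges to
  some \<open>L\<close>. Weighting \<open>A1\<close> by \<open>\<alpha>\<close> adds exactly \<open>ln \<alpha>\<close> to \<open>E_n\<close>. If \<open>r \<alpha> = \<gamma>\<close>, the normalised growth
  rates of the weighted \<open>M n\<close> tend to the joint spectral radius from below; their successive
  differences are \<open>(-1)^n (E_n + ln \<alpha>) / (q_n q_(n+1))\<close>, which would put infinitely many of them above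
  the limit unless \<open>L + ln \<alpha> = 0\<close>. So \<open>\<alpha> = exp (- L)\<close>. Existence of \<open>\<alpha>\<close> follows by the intermediate value
  theorem: \<open>r\<close> is continuous on \<open>(0, \<infinity>)\<close>, by compactness of the set of extremal words, and it tends to
  0 and 1 at the ends.\<close>

section \<open>Continued fractions and the characteristic Sturmian word\<close>

text \<open>Scaling \<open>A1\<close> by \<open>\<alpha>\<close> multiplies \<open>\<rho>_n\<close>
  by \<open>\<alpha> ^ p_n\<close>; the determinant
  \<open>p_(n+1) q_n - p_n q_(n+1) = (-1)^n\<close> is what turns this into a shift of
  \<open>E_n\<close> by \<open>ln \<alpha>\<close> independent of \<open>n\<close>. The growth rates
  are compared with the joint spectral radius from both sides: a Perron eigenvalue of a word is
  bounded by it through the powers of that word, while each \<open>s_n\<close> with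
  \<open>n \<ge> 1\<close> is a prefix of the Sturmian word with intercept 0, so the entry sums of
  its matrix grow at the extremal rate, and they are comparable to the eigenvalues because all left
  Perron vectors stay in one closed cone. Row vectors are the right side to look at. Products are
  formed in reverse, so a row vector meets the beginning of a word last, and the words
  \<open>s_n\<close> share their beginnings, whereas their last letters alternate. The obstacle to
  existence is that each clause of the Sturmian hypothesis speaks of a single weight. Different
  weights are compared through finite words, of which there are finitely many for each length; an
  extremal infinite word is recovered from them only after every prefix has been controlled, not
  just the full length.\<close>

fun cf_num :: "(nat \<Rightarrow> nat) \<Rightarrow> nat \<Rightarrow> nat" where
  "cf_num a 0 = 0"
| "cf_num a (Suc 0) = 1"
| "cf_num a (Suc (Suc n)) = a (Suc (Suc n)) * cf_num a (Suc n) + cf_num a n"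

fun cf_den :: "(nat \<Rightarrow> nat) \<Rightarrow> nat \<Rightarrow> nat" where
  "cf_den a 0 = 1"
| "cf_den a (Suc 0) = a 1"
| "cf_den a (Suc (Suc n)) = a (Suc (Suc n)) * cf_den a (Suc n) + cf_den a n"

text \<open>Words are indexed from 0, so \<open>s_(-1)\<close> occurs only as the literal
  \<open>[True]\<close> in the second equation.\<close>

fun std_word :: "(nat \<Rightarrow> nat) \<Rightarrow> nat \<Rightarrow> word" where
  "std_word a 0 = [False]"
| "std_word a (Suc 0) = word_power [False] (a 1 - 1) @ [True]"
| "std_word a (Suc (Suc n)) = word_power (std_word a (Suc n)) (a (Suc (Suc n))) @ std_word a n"

lemma length_word_power [simp]: "length (word_power u k) = k * length u"
  by (induction k) (auto simp: word_power_def)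

lemma count_list_word_power [simp]: "count_list (word_power u k) b = k * count_list u b"
  by (induction k) (auto simp: word_power_def)

lemma word_power_0 [simp]: "word_power u 0 = []"
  by (simp add: word_power_def)

lemma word_power_Suc [simp]: "word_power u (Suc k) = u @ word_power u k"
  by (simp add: word_power_def)

lemma set_word_power: "k > 0 \<Longrightarrow> set (word_power u k) = set u"
  by (auto simp: word_power_def)

lemma cf_det:
  "int (cf_num a (Suc n)) * int (cf_den a n) - int (cf_num a n) * int (cf_den a (Suc n)) = (- 1) ^ n"
proof (induction n)
  case (Suc n)
  then show ?case by (simp add: algebra_simps)
qed simp

lemma cf_coprime: "coprime (cf_num a n) (cf_den a n)"
proof -
  have "is_unit (int d)" if "d dvd cf_num a n" "d dvd cf_den a n" for d
  proof -
    have "int d dvd int (cf_num a (Suc n)) * int (cf_den a n) - int (cf_num a n) * int (cf_den a (Suc n))"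
      using that by (intro dvd_diff dvd_mult dvd_mult2) auto
    then have "int d dvd (- 1) ^ n" by (simp only: cf_det)
    then show ?thesis using dvd_trans[of "int d" "(- 1) ^ n" 1] by (simp add: is_unit_power_iff)
  qed
  then show ?thesis by (intro coprimeI) auto
qed

lemma cont_frac_eq_foldr: "cont_frac as = foldr (\<lambda>b t. 1 / (real b + t)) as 0"
  by (induction as) auto

text \<open>The theorem gives its denominators only as those of reduced fractions; this identifies
  them with \<open>cf_den\<close>.\<close>

lemma fraction_den_unique:
  fixes p q p' q' :: nat
  assumes "coprime p q" "coprime p' q'" "0 < q" "0 < q'" "real p / real q = real p' / real q'"
  shows "q = q'"
proof -
  have "real (p * q') = real (p' * q)" using assms(3-5) by (simp add: field_simps)
  then have eq: "p * q' = p' * q" by (simp only: of_nat_eq_iff)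
  have "q dvd p * q'" "q' dvd p' * q" using eq by (metis dvd_triv_right)+
  then show ?thesis using assms(1,2)
    by (metis coprime_commute coprime_dvd_mult_right_iff dvd_antisym)
qed

text \<open>Position \<open>j\<close> counts from 0, so it carries letter number
  \<open>j + 1\<close> of the Sturmian word with intercept 0; for irrational slope this is the
  characteristic word.\<close>

definition floor_word :: "real \<Rightarrow> nat \<Rightarrow> bool" where
  "floor_word \<gamma> j \<longleftrightarrow> \<lfloor>real (j + 2) * \<gamma>\<rfloor> \<noteq> \<lfloor>real (j + 1) * \<gamma>\<rfloor>"

lemma of_bool_floor_word:
  assumes "0 \<le> \<gamma>" "\<gamma> \<le> 1"
  shows "of_bool (floor_word \<gamma> j) = \<lfloor>real (j + 2) * \<gamma>\<rfloor> - \<lfloor>real (j + 1) * \<gamma>\<rfloor>"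
proof -
  have "real (j + 2) * \<gamma> = real (j + 1) * \<gamma> + \<gamma>" by (simp add: algebra_simps)
  then have "\<lfloor>real (j + 1) * \<gamma>\<rfloor> \<le> \<lfloor>real (j + 2) * \<gamma>\<rfloor>" "\<lfloor>real (j + 2) * \<gamma>\<rfloor> \<le> \<lfloor>real (j + 1) * \<gamma>\<rfloor> + 1"
    using assms by linarith+
  then show ?thesis unfolding floor_word_def by auto
qed

lemma floor_word_sturmian:
  assumes "0 \<le> \<gamma>" "\<gamma> \<le> 1"
  shows "floor_word \<gamma> \<in> sturmian_set \<gamma>"
proof -
  have "of_bool (floor_word \<gamma> (n - 1)) = \<lfloor>\<gamma> * real (n + 1) + 0\<rfloor> - \<lfloor>\<gamma> * real n + 0\<rfloor>" if "n \<ge> 1" for n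
    using of_bool_floor_word[of \<gamma> "n - 1"] that assms by (simp add: mult.commute)
  then show ?thesis unfolding sturmian_set_def by blast
qed

lemma count_list_floor_word:
  assumes "0 \<le> \<gamma>" "\<gamma> \<le> 1"
  shows "\<bar>real (count_list (map (floor_word \<gamma>) [j..<j + n]) True) - real n * \<gamma>\<bar> \<le> 1"
proof -
  have "int (count_list (map (floor_word \<gamma>) [j..<j + n]) True)
    = \<lfloor>real (j + n + 1) * \<gamma>\<rfloor> - \<lfloor>real (j + 1) * \<gamma>\<rfloor>"
  proof (induction n)
    case (Suc n)
    have "int (count_list (map (floor_word \<gamma>) [j..<j + Suc n]) True)
       = int (count_list (map (floor_word \<gamma>) [j..<j + n]) True) + of_bool (floor_word \<gamma> (j + n))"
      by simp
    also have "\<dots> = \<lfloor>real (j + Suc n + 1) * \<gamma>\<rfloor> - \<lfloor>real (j + 1) * \<gamma>\<rfloor>"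
      unfolding Suc.IH of_bool_floor_word[OF assms] by simp
    finally show ?case .
  qed simp
  moreover have "real (j + n + 1) * \<gamma> = real (j + 1) * \<gamma> + real n * \<gamma>" by (simp add: algebra_simps)
  ultimately show ?thesis by linarith
qed

locale continued_fraction =
  fixes \<gamma> :: real and a :: "nat \<Rightarrow> nat"
  assumes coeffs: "cont_frac_coefficients \<gamma> a"
    and gamma: "0 < \<gamma>" "\<gamma> < 1" "\<gamma> \<notin> \<rat>"
begin

abbreviation "num \<equiv> cf_num a"
abbreviation "den \<equiv> cf_den a"
abbreviation "w \<equiv> std_word a"

lemma a_pos: "n \<ge> 1 \<Longrightarrow> 0 < a n"
  using coeffs by (auto simp: cont_frac_coefficients_def)

lemma den_pos: "0 < den n"
proof (induction n rule: induct_nat_012)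
  case 1
  then show ?case using a_pos[of 1] by simp
qed auto

text \<open>The tail \<open>t\<close> must stay free: appending a coefficient \<open>b\<close> to
  the list replaces \<open>t\<close> by \<open>1 / (b + t)\<close> in the shorter expansion.\<close>

lemma foldr_convergent:
  assumes "0 \<le> t"
  shows "foldr (\<lambda>b t. 1 / (real b + t)) (map a [1..<Suc (Suc n)]) t
     = (real (num (Suc n)) + t * real (num n)) / (real (den (Suc n)) + t * real (den n))"
  using assms
proof (induction n arbitrary: t)
  case (Suc n)
  let ?b = "real (a (Suc (Suc n)))"
  have b: "?b > 0" using a_pos[of "Suc (Suc n)"] by simp
  have pos: "?b + t > 0" using b Suc.prems by simp
  have upt: "[1..<Suc (Suc (Suc n))] = [1..<Suc (Suc n)] @ [Suc (Suc n)]" by simp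
  have "foldr (\<lambda>b t. 1 / (real b + t)) (map a [1..<Suc (Suc (Suc n))]) t
     = foldr (\<lambda>b t. 1 / (real b + t)) (map a [1..<Suc (Suc n)]) (1 / (?b + t))"
    unfolding upt by simp
  also have "\<dots> = (real (num (Suc n)) + 1 / (?b + t) * real (num n)) / (real (den (Suc n)) + 1 / (?b + t) * real (den n))"
    using pos by (intro Suc.IH) simp
  also have "\<dots> = ((real (num (Suc n)) + 1 / (?b + t) * real (num n)) * (?b + t)) / ((real (den (Suc n)) + 1 / (?b + t) * real (den n)) * (?b + t))"
    using pos by simp
  also have "(real (num (Suc n)) + 1 / (?b + t) * real (num n)) * (?b + t) = real (num (Suc (Suc n))) + t * real (num (Suc n))"
    using pos by (simp add: field_simps)
  also have "(real (den (Suc n)) + 1 / (?b + t) * real (den n)) * (?b + t) = real (den (Suc (Suc n))) + t * real (den (Suc n))"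
    using pos by (simp add: field_simps)
  finally show ?case .
qed simp

lemma cont_frac_convergent: "cont_frac (map a [1..<n + 1]) = real (num n) / real (den n)"
proof (cases n)
  case (Suc m)
  show ?thesis using foldr_convergent[of 0 m] by (simp add: cont_frac_eq_foldr Suc del: upt_Suc)
qed simp

lemma convergent_lim: "(\<lambda>n. real (num n) / real (den n)) \<longlonglongrightarrow> \<gamma>"
  using coeffs unfolding cont_frac_coefficients_def cont_frac_convergent by simp

section \<open>Signed approximation errors of the convergents\<close>

definition eps :: "nat \<Rightarrow> real" where
  "eps n = real (den n) * \<gamma> - real (num n)"

lemma den_rec: "den (n + 2) = a (n + 2) * den (n + 1) + den n"
  and num_rec: "num (n + 2) = a (n + 2) * num (n + 1) + num n"
  by (simp_all add: numeral_2_eq_2)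

lemma eps_rec: "eps (n + 2) = real (a (n + 2)) * eps (n + 1) + eps n"
  by (simp add: eps_def den_rec num_rec algebra_simps)

lemma den_mono: "den n \<le> den (Suc n)"
proof (cases n)
  case 0
  then show ?thesis using a_pos[of 1] by simp
next
  case (Suc m)
  then show ?thesis using a_pos[of "Suc (Suc m)"] by (simp add: trans_le_add1)
qed

lemma cf_det_real: "real (num (Suc n)) * real (den n) - real (num n) * real (den (Suc n)) = (- 1) ^ n"
proof -
  have "real_of_int (int (num (Suc n)) * int (den n) - int (num n) * int (den (Suc n)))
    = real_of_int ((- 1) ^ n)" by (simp only: cf_det)
  then show ?thesis by simp
qed

lemma den_less: "den n < den (n + 2)"
  using den_rec[of n] a_pos[of "n + 2"] den_pos[of "n + 1"] by simp

text \<open>Up to the sign \<open>(-1)^n\<close>, two steps change a convergent by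
  \<open>1 / (q_n q_(n+1)) - 1 / (q_(n+1) q_(n+2))\<close>, and \<open>q_n < q_(n+2)\<close>. So the
  convergents of even index increase and those of odd index decrease.\<close>

lemma convergent_step2:
  "(- 1) ^ n * (real (num n) / real (den n)) < (- 1) ^ n * (real (num (n + 2)) / real (den (n + 2)))"
proof -
  let ?q0 = "real (den n)" and ?q1 = "real (den (n + 1))" and ?q2 = "real (den (n + 2))"
  have pos: "?q0 > 0" "?q1 > 0" "?q2 > 0"
    using den_pos[of n] den_pos[of "n + 1"] den_pos[of "n + 2"] by (simp_all del: cf_den.simps)
  have lt: "?q0 < ?q2" using den_less by simp
  have diff_frac: "x / u - y / v = c / (v * u)" if "x * v - y * u = c" "u > 0" "v > 0" for x y u v c :: real
    using that by (auto simp: field_simps)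
  have 1: "real (num (n + 1)) / ?q1 - real (num n) / ?q0 = (- 1) ^ n / (?q0 * ?q1)"
    using pos cf_det_real[of n] by (intro diff_frac) simp_all
  have 2: "real (num (n + 2)) / ?q2 - real (num (n + 1)) / ?q1 = - ((- 1) ^ n) / (?q1 * ?q2)"
    using pos cf_det_real[of "Suc n"] by (intro diff_frac) (simp_all del: cf_num.simps cf_den.simps)
  have "real (num (n + 2)) / ?q2 - real (num n) / ?q0 = (- 1) ^ n * (1 / (?q0 * ?q1) - 1 / (?q1 * ?q2))"
    using 1 2 by (simp add: algebra_simps del: cf_num.simps cf_den.simps)
  then have "(- 1) ^ n * (real (num (n + 2)) / ?q2) - (- 1) ^ n * (real (num n) / ?q0)
      = ((- 1) ^ n * (- 1) ^ n) * (1 / (?q0 * ?q1) - 1 / (?q1 * ?q2))"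
    by (simp only: mult.assoc flip: right_diff_distrib)
  also have "((- 1) ^ n * (- 1) ^ n) = (1::real)" by (simp flip: power_add)
  finally have eq: "(- 1) ^ n * (real (num (n + 2)) / ?q2) - (- 1) ^ n * (real (num n) / ?q0)
      = 1 / (?q0 * ?q1) - 1 / (?q1 * ?q2)" by simp
  have "0 < 1 / (?q0 * ?q1) - 1 / (?q1 * ?q2)"
    using pos lt by (simp add: frac_less2 mult.commute[of ?q1] del: cf_den.simps)
  then show ?thesis using eq by linarith
qed

text \<open>Along the indices of one parity the convergents approach \<open>\<gamma>\<close>
  strictly monotonically, so all of them lie on the same side of it.\<close>

lemma eps_sign: "0 < (- 1) ^ n * eps n"
proof -
  define c where "c k = (- 1) ^ n * (real (num (n + 2 * k)) / real (den (n + 2 * k)))" for k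
  have step: "c k < c (Suc k)" for k
    using convergent_step2[of "n + 2 * k"] by (simp add: c_def power_add power_mult)
  then have "incseq c" by (intro incseq_SucI less_imp_le)
  moreover have "c \<longlonglongrightarrow> (- 1) ^ n * \<gamma>"
    unfolding c_def
    by (intro tendsto_mult_left LIMSEQ_subseq_LIMSEQ[OF convergent_lim, of "\<lambda>k. n + 2 * k", unfolded o_def])
       (auto simp: strict_mono_def)
  ultimately have "c 1 \<le> (- 1) ^ n * \<gamma>" by (rule incseq_le)
  with step[of 0] have "c 0 < (- 1) ^ n * \<gamma>" by simp
  then have "c 0 * real (den n) < (- 1) ^ n * \<gamma> * real (den n)"
    using den_pos[of n] by simp
  then show ?thesis using den_pos[of n] by (simp add: c_def eps_def algebra_simps)
qed

lemma abs_eps: "\<bar>eps n\<bar> = (- 1) ^ n * eps n"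
  using eps_sign[of n] by (cases "even n") auto

lemma abs_eps_rec: "\<bar>eps n\<bar> = real (a (n + 2)) * \<bar>eps (n + 1)\<bar> + \<bar>eps (n + 2)\<bar>"
  using abs_eps[of n] abs_eps[of "n + 1"] abs_eps[of "n + 2"] eps_rec[of n]
  by (simp add: algebra_simps)

lemma abs_eps_less: "\<bar>eps (Suc n)\<bar> < \<bar>eps n\<bar>"
proof -
  have "1 * \<bar>eps (n + 1)\<bar> \<le> real (a (n + 2)) * \<bar>eps (n + 1)\<bar>"
    using a_pos[of "n + 2"] by (intro mult_right_mono) auto
  moreover have "0 < \<bar>eps (n + 2)\<bar>" using eps_sign[of "n + 2"] by auto
  ultimately show ?thesis using abs_eps_rec[of n] by simp
qed

text \<open>The vectors \<open>(q_n, p_n)\<close> and \<open>(q_(n+1), p_(n+1))\<close> form a basis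
  of the integer lattice, so \<open>(j, m)\<close> is a combination of them with integer
  coefficients \<open>x\<close> and \<open>y\<close>. The range of \<open>j\<close> excludes
  \<open>x = 0\<close> and excludes equal signs of \<open>x\<close> and \<open>y\<close>; as
  consecutive errors have opposite signs, the two contributions to the error add up without
  cancellation.\<close>

lemma best_approximation:
  assumes "1 \<le> j" "j < den (Suc n)"
  shows "\<bar>eps n\<bar> \<le> \<bar>real j * \<gamma> - of_int m\<bar>"
proof -
  let ?p = "int (num n)" and ?q = "int (den n)" and ?P = "int (num (Suc n))" and ?Q = "int (den (Suc n))"
  define sg :: int where "sg = (- 1) ^ n"
  have sg: "sg * sg = 1" by (simp add: sg_def flip: power_add)
  have det: "?P * ?q - ?p * ?Q = sg" unfolding sg_def by (rule cf_det)
  \<comment> \<open>Cramer's rule; multiplying by the determinant \<open>sg\<close> replaces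
    dividing by it, since \<open>sg\<close> is its own inverse.\<close>
  define x where "x = sg * (int j * ?P - m * ?Q)"
  define y where "y = sg * (m * ?q - int j * ?p)"
  have "x * ?q + y * ?Q = sg * (int j * (?P * ?q - ?p * ?Q))"
    by (simp add: x_def y_def algebra_simps)
  then have j: "int j = x * ?q + y * ?Q" using det sg by (simp add: algebra_simps)
  have "x * ?p + y * ?P = sg * (m * (?P * ?q - ?p * ?Q))"
    by (simp add: x_def y_def algebra_simps)
  then have m: "m = x * ?p + y * ?P" using det sg by (simp add: algebra_simps)
  have val: "real j * \<gamma> - of_int m = of_int x * eps n + of_int y * eps (Suc n)"
  proof -
    have "real j = of_int (int j)" by simp
    also have "\<dots> = of_int x * real (den n) + of_int y * real (den (Suc n))"
      by (subst j) simp
    finally have 1: "real j = of_int x * real (den n) + of_int y * real (den (Suc n))" .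
    have 2: "of_int m = of_int x * real (num n) + of_int y * real (num (Suc n))" by (subst m) simp
    show ?thesis unfolding 1 2 by (simp add: eps_def algebra_simps)
  qed
  have Q: "?Q > 0" and q: "?q > 0" using den_pos by auto
  have x0: "x \<noteq> 0"
  proof
    assume "x = 0"
    then have *: "int j = y * ?Q" using j by simp
    then have "y > 0" using assms(1) Q by (smt (verit) of_nat_1 of_nat_mono zero_less_mult_pos2)
    then have "1 * ?Q \<le> y * ?Q" using Q by (intro mult_right_mono) auto
    then show False using * assms(2) by linarith
  qed
  have opp: "x * y \<le> 0"
  proof (rule ccontr)
    assume "\<not> x * y \<le> 0"
    then have "(x \<ge> 1 \<and> y \<ge> 1) \<or> (x \<le> -1 \<and> y \<le> -1)" by (smt (verit) mult_le_0_iff)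
    then show False
    proof
      assume "x \<ge> 1 \<and> y \<ge> 1"
      then have "x * ?q \<ge> 0" "y * ?Q \<ge> 1 * ?Q" using q Q by (auto intro: mult_right_mono)
      then show False using j assms(2) by simp
    next
      assume "x \<le> -1 \<and> y \<le> -1"
      then have "x * ?q \<le> 0" "y * ?Q \<le> 0" using q Q by (auto simp: mult_le_0_iff)
      then show False using j assms(1) by simp
    qed
  qed
  have sgn: "eps (Suc n) * eps n < 0"
  proof -
    have "0 < ((- 1) ^ n * eps n) * ((- 1) ^ Suc n * eps (Suc n))"
      by (intro mult_pos_pos eps_sign)
    also have "\<dots> = - ((- 1) ^ n * (- 1) ^ n) * (eps n * eps (Suc n))" by (simp add: algebra_simps)
    also have "(- 1) ^ n * (- 1) ^ n = (1::real)" by (simp flip: power_add)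
    finally show ?thesis by (simp add: mult.commute)
  qed
  have abs_add: "\<bar>u + v\<bar> = \<bar>u\<bar> + \<bar>v\<bar>" if "0 \<le> u * v" for u v :: real
    using that by (auto simp: zero_le_mult_iff)
  have "(of_int x * eps n) * (of_int y * eps (Suc n)) = of_int (x * y) * (eps (Suc n) * eps n)"
    by simp
  also have "\<dots> \<ge> 0" using opp sgn by (simp only: mult_nonpos_nonpos of_int_le_0_iff less_imp_le)
  finally have "\<bar>of_int x * eps n + of_int y * eps (Suc n)\<bar> = \<bar>of_int x * eps n\<bar> + \<bar>of_int y * eps (Suc n)\<bar>"
    by (intro abs_add)
  then have "\<bar>of_int x * eps n\<bar> \<le> \<bar>real j * \<gamma> - of_int m\<bar>" unfolding val by simp
  moreover have "1 * \<bar>eps n\<bar> \<le> \<bar>of_int x\<bar> * \<bar>eps n\<bar>"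
    using x0 by (intro mult_right_mono) linarith+
  ultimately show ?thesis by (simp add: abs_mult)
qed

section \<open>The characteristic word and its periods\<close>

lemma irrational_multiple: "j \<noteq> 0 \<Longrightarrow> real j * \<gamma> \<noteq> of_int m"
proof
  assume "j \<noteq> 0" "real j * \<gamma> = of_int m"
  then have "\<gamma> = of_int m / of_nat j" by (simp add: field_simps)
  then show False using gamma(3) by (metis Rats_divide Rats_of_int Rats_of_nat)
qed

text \<open>Up to the integer \<open>num n\<close>, a shift by \<open>den n\<close> moves
  \<open>j * \<gamma>\<close> by \<open>eps n\<close>, and \<open>j * \<gamma>\<close> keeps at
  least that distance from every integer, so no integer is crossed. Landing exactly on the upper one
  would make \<open>\<gamma>\<close> rational.\<close>

lemma floor_periodic:
  assumes "1 \<le> j" "j < den (Suc n)"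
  shows "\<lfloor>real (j + den n) * \<gamma>\<rfloor> = \<lfloor>real j * \<gamma>\<rfloor> + int (num n)"
proof -
  let ?K = "\<lfloor>real j * \<gamma>\<rfloor>"
  have eq: "real (j + den n) * \<gamma> = real j * \<gamma> + eps n + of_int (int (num n))"
    by (simp add: eps_def algebra_simps)
  have K: "of_int ?K \<le> real j * \<gamma>" "real j * \<gamma> < of_int ?K + 1" by linarith+
  have b1: "\<bar>eps n\<bar> \<le> real j * \<gamma> - of_int ?K"
    using best_approximation[OF assms, of ?K] K(1) by simp
  have b2: "\<bar>eps n\<bar> \<le> of_int ?K + 1 - real j * \<gamma>"
    using best_approximation[OF assms, of "?K + 1"] K(2) by simp
  have "real j * \<gamma> + eps n \<noteq> of_int ?K + 1"
    using irrational_multiple[of "j + den n" "?K + 1 + int (num n)"] assms(1) eq by auto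
  then have "\<lfloor>real j * \<gamma> + eps n\<rfloor> = ?K" using b1 b2 by (intro floor_unique) linarith+
  then show ?thesis unfolding eq floor_add_int by simp
qed

abbreviation "char_word \<equiv> floor_word \<gamma>"

lemma char_word_periodic:
  assumes "j + 2 < den (Suc n)"
  shows "char_word (j + den n) = char_word j"
  using floor_periodic[of "j + 1" n] floor_periodic[of "j + 2" n] assms
  unfolding floor_word_def by (simp add: algebra_simps)

lemma floor_den: "\<lfloor>real (den (Suc n)) * \<gamma>\<rfloor> = int (num (Suc n)) - of_bool (even n)"
proof -
  have eq: "real (den (Suc n)) * \<gamma> = eps (Suc n) + of_int (int (num (Suc n)))" by (simp add: eps_def)
  have e: "\<bar>eps (Suc n)\<bar> < 1"
  proof (induction n)
    case 0
    have "\<bar>eps 0\<bar> < 1" using gamma by (simp add: eps_def)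
    then show ?case using abs_eps_less[of 0] by simp
  next
    case (Suc n)
    then show ?case using abs_eps_less[of "Suc n"] by simp
  qed
  have "\<lfloor>eps (Suc n)\<rfloor> = - of_bool (even n)"
  proof (cases "even n")
    case True
    then have "eps (Suc n) < 0" using eps_sign[of "Suc n"] by simp
    then show ?thesis using e True by (simp add: floor_eq_iff)
  next
    case False
    then have "eps (Suc n) > 0" using eps_sign[of "Suc n"] by simp
    then show ?thesis using e False by (simp add: floor_eq_iff)
  qed
  then show ?thesis unfolding eq floor_add_int[symmetric] by simp
qed

lemma floor_den_add:
  "\<lfloor>real (den (Suc n) + den n) * \<gamma>\<rfloor> = int (num (Suc n)) + int (num n) - of_bool (odd n)"
proof -
  have eq: "real (den (Suc n) + den n) * \<gamma> = (eps (Suc n) + eps n) + of_int (int (num (Suc n)) + int (num n))"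
    by (simp add: eps_def algebra_simps)
  have "\<bar>eps 0\<bar> < 1" using gamma by (simp add: eps_def)
  then have e: "\<bar>eps n\<bar> < 1"
  proof (induction n)
    case (Suc n)
    then show ?case using abs_eps_less[of "n"] by simp
  qed
  have "\<lfloor>eps (Suc n) + eps n\<rfloor> = - of_bool (odd n)"
  proof (cases "even n")
    case True
    then have "eps (Suc n) < 0" "eps n > 0" using eps_sign[of "Suc n"] eps_sign[of n] by simp_all
    then show ?thesis using e abs_eps_less[of n] True by (simp add: floor_eq_iff)
  next
    case False
    then have "eps (Suc n) > 0" "eps n < 0" using eps_sign[of "Suc n"] eps_sign[of n] by simp_all
    then show ?thesis using e abs_eps_less[of n] False by (simp add: floor_eq_iff)
  qed
  then show ?thesis unfolding eq floor_add_int[symmetric] by simp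
qed

lemma length_std_word: "length (w n) = den n"
proof (induction n rule: induct_nat_012)
  case 1
  then show ?case using a_pos[of 1] by simp
qed auto

lemma count_list_std_word: "count_list (w n) True = num n"
  by (induction n rule: induct_nat_012) auto

text \<open>For \<open>den n = 1\<close> this is the one letter of the prefix of length
  \<open>den (Suc n)\<close> that the period does not determine. It is read off from the signs of
  the errors instead.\<close>

lemma char_word_den_minus_1: "char_word (den (Suc n) - 1) \<longleftrightarrow> even n \<or> num n \<noteq> 1"
  if "den n = 1"
proof -
  have eq: "den (Suc n) - 1 + 2 = den (Suc n) + den n" "den (Suc n) - 1 + 1 = den (Suc n)"
    using den_pos[of "Suc n"] that by simp_all
  show ?thesis unfolding floor_word_def eq floor_den floor_den_add by auto
qed

text \<open>The induction removes one block of length \<open>den n\<close> from the front. The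
  letters of the first block need no comparison with a shifted copy, so the bound on the total
  length gains an extra \<open>den n\<close>.\<close>

lemma map_char_word_periodic:
  assumes "k * den n + m + 2 \<le> den (Suc n) + den n"
  shows "map char_word [0..<k * den n + m] = word_power (map char_word [0..<den n]) k @ map char_word [0..<m]"
  using assms
proof (induction k)
  case (Suc k)
  let ?L = "k * den n + m"
  have "map char_word [0..<Suc k * den n + m] = map char_word [0..<den n + ?L]"
    by (simp add: algebra_simps)
  also have "\<dots> = map char_word [0..<den n] @ map char_word [den n..<den n + ?L]"
    by (subst upt_add_eq_append) simp_all
  also have "map char_word [den n..<den n + ?L] = map char_word [0..<?L]"
  proof (rule nth_equalityI)
    fix j assume "j < length (map char_word [den n..<den n + ?L])"
    then have "j < ?L" by simp
    then have "j + 2 < den (Suc n)" using Suc.prems by (simp del: cf_den.simps)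
    from char_word_periodic[OF this] \<open>j < ?L\<close>
    show "map char_word [den n..<den n + ?L] ! j = map char_word [0..<?L] ! j"
      by (simp add: add.commute del: cf_den.simps)
  qed simp
  also have "\<dots> = word_power (map char_word [0..<den n]) k @ map char_word [0..<m]"
    using Suc.prems by (intro Suc.IH) (simp del: cf_den.simps)
  finally show ?case by simp
qed simp

lemma den_ge_2: "2 \<le> den (n + 2)"
  using den_less[of n] den_pos[of n] by linarith

text \<open>The base cases are singled out because \<open>den n\<close> may equal 1 there, and then the last letter
  falls outside the range of the periodicity.\<close>

lemma map_char_word_den: "n \<ge> 1 \<Longrightarrow> map char_word [0..<den n] = w n"
proof (induction n rule: less_induct)
  case (less n)
  consider "n = 1" | "n = 2" "a 1 = 1" | m where "n = m + 2" "2 \<le> den (m + 1)"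
  proof (cases "n = 1 \<or> n = 2 \<and> a 1 = 1")
    case False
    then have "n \<ge> 2" using less.prems by linarith
    then obtain m where m: "n = m + 2" by (metis add.commute le_Suc_ex)
    have "2 \<le> den (m + 1)"
    proof (cases m)
      case 0
      then show ?thesis using False m a_pos[of 1] by simp
    next
      case (Suc l)
      then show ?thesis using den_ge_2[of l] by simp
    qed
    then show ?thesis using m that by blast
  qed (use that in blast)
  then show ?case
  proof cases
    case 1
    obtain c where c: "a 1 = Suc c" using a_pos[of 1] gr0_implies_Suc by auto
    have "char_word c" using char_word_den_minus_1[of 0] c by simp
    have "map char_word [0..<c] = word_power [False] c"
    proof (cases c)
      case (Suc d)
      have "char_word 0 = False"
      proof -
        have "\<lfloor>real (1 + 0) * \<gamma>\<rfloor> = 0" using gamma by (simp add: floor_eq_iff)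
        moreover have "\<lfloor>real (1 + 1) * \<gamma>\<rfloor> = \<lfloor>real 1 * \<gamma>\<rfloor> + int (num 0)"
          using floor_periodic[of 1 0] c Suc by simp
        ultimately show ?thesis by (simp add: floor_word_def)
      qed
      then show ?thesis using map_char_word_periodic[of c 0 0] c Suc by simp
    qed simp
    then show ?thesis using \<open>char_word c\<close> c 1 by simp
  next
    case 2
    have "\<not> char_word (den 2 - 1)" using char_word_den_minus_1[of 1] 2 by (simp add: numeral_2_eq_2)
    moreover have d2: "den 2 = Suc (a 2)" using 2 by (simp add: numeral_2_eq_2)
    moreover have "map char_word [0..<a 2] = word_power (map char_word [0..<1]) (a 2)"
      using map_char_word_periodic[of "a 2" 1 0] 2 by (simp add: numeral_2_eq_2)
    moreover have "map char_word [0..<1] = w 1" using less.IH[of 1] 2 by simp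
    ultimately show ?thesis using 2 by (simp add: numeral_2_eq_2)
  next
    case (3 m)
    have 1: "map char_word [0..<den (m + 1)] = w (m + 1)" using less.IH[of "m + 1"] 3 by simp
    have 2: "map char_word [0..<den m] = w m"
    proof (cases m)
      case 0
      have "char_word 0 = hd (map char_word [0..<den 1])" using den_pos[of 1] by (simp add: hd_map del: cf_den.simps)
      also have "map char_word [0..<den 1] = w 1" using 1 0 by simp
      finally have "char_word 0 = hd (w 1)" .
      moreover have "a 1 \<ge> 2" using 3 0 by simp
      ultimately have "char_word 0 = False" by (cases "a 1 - 1") auto
      then show ?thesis using 0 by simp
    next
      case (Suc l)
      then show ?thesis using less.IH[of m] 3 by simp
    qed
    have "den n = a n * den (m + 1) + den m" using 3 den_rec[of m] by simp
    moreover have "map char_word [0..<a n * den (m + 1) + den m] = word_power (map char_word [0..<den (m + 1)]) (a n) @ map char_word [0..<den m]"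
      using 3 den_rec[of m] by (intro map_char_word_periodic) simp
    ultimately show ?thesis using 1 2 3 by (simp del: cf_den.simps add: numeral_2_eq_2)
  qed
qed

lemma den_strict: "n \<ge> 1 \<Longrightarrow> den n < den (Suc n)"
proof -
  assume "n \<ge> 1"
  then obtain m where "n = Suc m" by (cases n) auto
  then show ?thesis using den_rec[of m] a_pos[of "m + 2"] den_pos[of m] den_pos[of "m + 1"]
    by (cases "a (m + 2)") auto
qed

lemma den_ge: "n \<le> den n"
proof (induction n)
  case (Suc n)
  show ?case
  proof (cases "n = 0")
    case True
    then show ?thesis using den_pos[of 1] by simp
  next
    case False
    then show ?thesis using den_strict[of n] Suc by simp
  qed
qed simp

text \<open>Before index 2 a letter may be missing: \<open>w 1\<close> is \<open>[True]\<close> when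
  \<open>a 1 = 1\<close>. This is where the threshold \<open>n \<ge> 2\<close> for positive matrices
  comes from.\<close>

lemma std_word_letters: "n \<ge> 2 \<Longrightarrow> set (w n) = {False, True}"
proof (induction n rule: nat_induct_at_least)
  case base
  have "set (w 2) = set (w 1) \<union> {False}"
    using a_pos[of 2] by (simp add: numeral_2_eq_2 set_word_power)
  moreover have "True \<in> set (w 1)" by simp
  moreover have "set (w 2) \<subseteq> {False, True}" by auto
  ultimately show ?case by auto
next
  case (Suc n)
  then obtain m where "n = Suc m" by (cases n) auto
  then have "set (w n) \<subseteq> set (w (Suc n))"
    using a_pos[of "Suc (Suc m)"] by (auto simp: set_word_power)
  moreover have "set (w (Suc n)) \<subseteq> {False, True}" by auto
  ultimately show ?case using Suc by auto
qed

end

section \<open>Two-by-two matrices and the Hilbert metric\<close>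

definition pos_mat :: "real^2^2 \<Rightarrow> bool" where
  "pos_mat M \<longleftrightarrow> (\<forall>i j. 0 < M $ i $ j)"

definition pos_vec :: "real^2 \<Rightarrow> bool" where
  "pos_vec v \<longleftrightarrow> (\<forall>i. 0 < v $ i)"

text \<open>The logarithm of the slope of a positive row vector; \<open>\<bar>log_slope v - log_slope w\<bar>\<close> is
  Hilbert's projective distance of \<open>v\<close> and \<open>w\<close>.\<close>

definition log_slope :: "real^2 \<Rightarrow> real" where
  "log_slope v = ln (v $ 1) - ln (v $ 2)"

definition contracts :: "real^2^2 \<Rightarrow> real \<Rightarrow> bool" where
  "contracts M k \<longleftrightarrow> (\<forall>v w. pos_vec v \<longrightarrow> pos_vec w \<longrightarrow>
     \<bar>log_slope (v v* M) - log_slope (w v* M)\<bar> \<le> k * \<bar>log_slope v - log_slope w\<bar>)"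

lemma vector_matrix_mult_2: "(v v* M) $ j = v $ 1 * M $ 1 $ j + v $ 2 * M $ 2 $ j" for M :: "real^2^2"
  by (simp add: vector_matrix_mult_def sum_2)

lemma matrix_vector_mult_2: "(M *v x) $ i = M $ i $ 1 * x $ 1 + M $ i $ 2 * x $ 2" for M :: "'a::comm_semiring_1^2^2"
  by (simp add: matrix_vector_mult_def sum_2)

lemma inner_2: "v \<bullet> w = v $ 1 * w $ 1 + v $ 2 * w $ 2" for v w :: "real^2"
  by (simp add: inner_vec_def sum_2)

lemma pos_vec_row: "pos_vec v \<Longrightarrow> pos_mat M \<Longrightarrow> pos_vec (v v* M)"
  by (auto simp: pos_vec_def pos_mat_def vector_matrix_mult_2 intro!: add_pos_pos)

lemma pos_vec_col: "pos_vec v \<Longrightarrow> pos_mat M \<Longrightarrow> pos_vec (M *v v)"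
  by (auto simp: pos_vec_def pos_mat_def matrix_vector_mult_2 intro!: add_pos_pos)

lemma pos_vec_inner: "pos_vec v \<Longrightarrow> pos_vec w \<Longrightarrow> 0 < v \<bullet> w"
  by (auto simp: pos_vec_def inner_2 intro!: add_pos_pos)

lemma log_slope_scale: "pos_vec v \<Longrightarrow> 0 < c \<Longrightarrow> log_slope (c *s v) = log_slope v"
  by (simp add: pos_vec_def log_slope_def ln_mult_pos)

section \<open>Eigenvalues and Perron vectors of two-by-two matrices\<close>

lemma char_roots_2x2:
  fixes a b c d :: real
  defines "D \<equiv> sqrt ((a - d)\<^sup>2 + 4 * b * c)"
  assumes "0 \<le> b * c"
  shows "(a - (a + d + D) / 2) * (d - (a + d + D) / 2) = b * c"
    and "(a - (a + d - D) / 2) * (d - (a + d - D) / 2) = b * c"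
proof -
  have "D\<^sup>2 = (a - d)\<^sup>2 + 4 * b * c" unfolding D_def using assms by simp
  then show "(a - (a + d + D) / 2) * (d - (a + d + D) / 2) = b * c"
    and "(a - (a + d - D) / 2) * (d - (a + d - D) / 2) = b * c"
    by (simp_all add: field_simps power2_eq_square)
qed

lemma complex_eigenvalue_2x2:
  fixes B :: "complex^2^2"
  shows "(\<exists>v. v \<noteq> 0 \<and> B *v v = z *s v) \<longleftrightarrow> (B $ 1 $ 1 - z) * (B $ 2 $ 2 - z) = B $ 1 $ 2 * B $ 2 $ 1"
    (is "?L \<longleftrightarrow> ?R")
proof -
  let ?a = "B $ 1 $ 1" and ?b = "B $ 1 $ 2" and ?c = "B $ 2 $ 1" and ?d = "B $ 2 $ 2"
  have ev: "B *v v = z *s v \<longleftrightarrow> ?a * v $ 1 + ?b * v $ 2 = z * v $ 1 \<and> ?c * v $ 1 + ?d * v $ 2 = z * v $ 2" for v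
    by (simp add: vec_eq_iff forall_2 matrix_vector_mult_2)
  have nz: "v \<noteq> 0 \<longleftrightarrow> v $ 1 \<noteq> 0 \<or> v $ 2 \<noteq> 0" for v :: "complex^2"
    by (simp add: vec_eq_iff forall_2)
  show ?thesis
  proof
    assume ?L
    then obtain v :: "complex^2" where v: "v $ 1 \<noteq> 0 \<or> v $ 2 \<noteq> 0"
      and e1: "?a * v $ 1 + ?b * v $ 2 = z * v $ 1" and e2: "?c * v $ 1 + ?d * v $ 2 = z * v $ 2"
      unfolding ev nz by blast
    have "((?a - z) * (?d - z) - ?b * ?c) * v $ 1 = 0" "((?a - z) * (?d - z) - ?b * ?c) * v $ 2 = 0"
      using e1 e2 by algebra+
    then show ?R using v by auto
  next
    assume R: ?R
    \<comment> \<open>The eigenvector is read off from a nonzero row of \<open>B - z\<close>, if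
      there is one.\<close>
    consider "?b \<noteq> 0 \<or> ?a \<noteq> z" | "?b = 0" "?a = z" "?c \<noteq> 0 \<or> ?d \<noteq> z" | "?b = 0" "?a = z" "?c = 0" "?d = z"
      by blast
    then show ?L
    proof cases
      case 1
      then show ?thesis unfolding ev nz using R
        by (intro exI[of _ "vector [?b, z - ?a]"]) (auto simp: algebra_simps)
    next
      case 2
      then show ?thesis unfolding ev nz
        by (intro exI[of _ "vector [z - ?d, ?c]"]) (auto simp: algebra_simps)
    next
      case 3
      then show ?thesis unfolding ev nz by (intro exI[of _ "vector [1, 0]"]) auto
    qed
  qed
qed

text \<open>A non-negative product of the off-diagonal entries makes both eigenvalues real, and a
  non-negative trace makes the larger one dominate in modulus.\<close>

lemma spectral_radius_2x2:
  fixes M :: "real^2^2"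
  assumes "\<And>i j. 0 \<le> M $ i $ j"
  shows "spectral_radius M = (M $ 1 $ 1 + M $ 2 $ 2 + sqrt ((M $ 1 $ 1 - M $ 2 $ 2)\<^sup>2 + 4 * M $ 1 $ 2 * M $ 2 $ 1)) / 2"
proof -
  let ?a = "M $ 1 $ 1" and ?b = "M $ 1 $ 2" and ?c = "M $ 2 $ 1" and ?d = "M $ 2 $ 2"
  define D where "D = sqrt ((?a - ?d)\<^sup>2 + 4 * ?b * ?c)"
  define l where "l = (?a + ?d + D) / 2"
  define m where "m = (?a + ?d - D) / 2"
  have bc: "0 \<le> ?b * ?c" using assms by simp
  have D: "D \<ge> 0" unfolding D_def by (intro real_sqrt_ge_zero add_nonneg_nonneg) (use bc in auto)
  have roots: "(?a - l) * (?d - l) = ?b * ?c" "(?a - m) * (?d - m) = ?b * ?c"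
    unfolding l_def m_def D_def by (rule char_roots_2x2[OF bc])+
  have lm: "l + m = ?a + ?d" unfolding l_def m_def by (simp add: field_simps)
  then have prod: "l * m = ?a * ?d - ?b * ?c" using roots(1) by algebra
  have "{z. \<exists>v::complex^2. v \<noteq> 0 \<and> map_matrix complex_of_real M *v v = z *s v}
     = {complex_of_real l, complex_of_real m}"
  proof -
    have "(complex_of_real ?a - z) * (complex_of_real ?d - z) = complex_of_real ?b * complex_of_real ?c
       \<longleftrightarrow> z = complex_of_real l \<or> z = complex_of_real m" for z
    proof -
      have 1: "complex_of_real l + complex_of_real m = complex_of_real ?a + complex_of_real ?d"
        using lm by (simp flip: of_real_add)
      have 2: "complex_of_real l * complex_of_real m = complex_of_real ?a * complex_of_real ?d - complex_of_real ?b * complex_of_real ?c"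
        using prod by (simp flip: of_real_mult of_real_diff)
      have "(complex_of_real ?a - z) * (complex_of_real ?d - z) - complex_of_real ?b * complex_of_real ?c
        = (z - complex_of_real l) * (z - complex_of_real m)"
        using 1 2 by algebra
      then show ?thesis by (metis eq_iff_diff_eq_0 mult_eq_0_iff)
    qed
    then show ?thesis unfolding complex_eigenvalue_2x2 by (auto simp: map_matrix_def)
  qed
  then have "spectral_radius M = max \<bar>l\<bar> \<bar>m\<bar>" unfolding spectral_radius_def by simp
  also have "\<dots> = l" using D assms[of 1 1] assms[of 2 2] unfolding l_def m_def by (simp add: max_def abs_if field_simps)
  finally show ?thesis unfolding l_def D_def .
qed

lemma spectral_radius_pos:
  fixes M :: "real^2^2"
  assumes "\<And>i j. 0 \<le> M $ i $ j" "0 < trace M"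
  shows "0 < spectral_radius M"
proof -
  have "0 \<le> sqrt ((M $ 1 $ 1 - M $ 2 $ 2)\<^sup>2 + 4 * M $ 1 $ 2 * M $ 2 $ 1)"
    using assms(1) by (intro real_sqrt_ge_zero add_nonneg_nonneg mult_nonneg_nonneg) auto
  then show ?thesis using assms(2) unfolding spectral_radius_2x2[OF assms(1)]
    by (simp only: trace_def sum_2) (rule divide_pos_pos[OF add_pos_nonneg], simp_all)
qed

text \<open>The eigenvectors are explicit. With \<open>l\<close> the larger root,
  \<open>l - M $ 1 $ 1\<close> is positive because the product of the off-diagonal entries is; one
  coordinate of the eigenvector equation is trivial, the other is the characteristic
  equation.\<close>

lemma perron_2x2:
  assumes "pos_mat M"
  obtains v u where "pos_vec v" "pos_vec u"
    "v v* M = spectral_radius M *s v" "M *v u = spectral_radius M *s u"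
proof -
  let ?a = "M $ 1 $ 1" and ?b = "M $ 1 $ 2" and ?c = "M $ 2 $ 1" and ?d = "M $ 2 $ 2"
  define D where "D = sqrt ((?a - ?d)\<^sup>2 + 4 * ?b * ?c)"
  define l where "l = (?a + ?d + D) / 2"
  have pos: "0 < ?a" "0 < ?b" "0 < ?c" "0 < ?d" using assms by (auto simp: pos_mat_def)
  have l: "spectral_radius M = l" unfolding l_def D_def
    using assms by (intro spectral_radius_2x2) (auto simp: pos_mat_def less_imp_le)
  have bc: "0 \<le> ?b * ?c" using pos by simp
  have root: "(?a - l) * (?d - l) = ?b * ?c"
    unfolding l_def D_def by (rule char_roots_2x2[OF bc])
  have "sqrt ((?a - ?d)\<^sup>2) < D" unfolding D_def using pos by (intro real_sqrt_less_mono) simp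
  then have la: "?a < l" unfolding l_def by simp
  show ?thesis
  proof (rule that[of "vector [?c, l - ?a]" "vector [?b, l - ?a]"])
    show "pos_vec (vector [?c, l - ?a])" "pos_vec (vector [?b, l - ?a])"
      using pos la by (auto simp: pos_vec_def forall_2)
    show "vector [?c, l - ?a] v* M = spectral_radius M *s vector [?c, l - ?a]"
      "M *v vector [?b, l - ?a] = spectral_radius M *s vector [?b, l - ?a]"
      using root by (auto simp: vec_eq_iff forall_2 matrix_vector_mult_2 vector_matrix_mult_2 l algebra_simps)
  qed
qed

section \<open>Mediant inequalities and the contraction of Hilbert's metric\<close>

lemma ln_mediant_bounds:
  fixes x1 :: real
  assumes "0 < v1" "0 < v2" "0 < w1" "0 < w2" "0 \<le> x1" "0 \<le> x2" "0 < x1 + x2"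
    and le: "ln v1 - ln w1 \<le> ln v2 - ln w2"
  shows "ln v1 - ln w1 \<le> ln (v1 * x1 + v2 * x2) - ln (w1 * x1 + w2 * x2)"
    and "ln (v1 * x1 + v2 * x2) - ln (w1 * x1 + w2 * x2) \<le> ln v2 - ln w2"
proof -
  have pos: "0 < c1 * x1 + c2 * x2" if "0 < c1" "0 < c2" for c1 c2
    using that assms by (smt (verit) mult_nonneg_nonneg mult_pos_pos)
  have "ln (v1 * w2) \<le> ln (v2 * w1)" using le assms by (simp add: ln_mult)
  then have ratio: "v1 * w2 \<le> v2 * w1" using assms by (simp add: ln_le_cancel_iff)
  have "v1 * w2 * x2 \<le> v2 * w1 * x2" "v1 * w2 * x1 \<le> v2 * w1 * x1"
    using ratio assms by (auto intro: mult_right_mono)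
  then have "v1 * (w1 * x1 + w2 * x2) \<le> w1 * (v1 * x1 + v2 * x2)"
    "w2 * (v1 * x1 + v2 * x2) \<le> v2 * (w1 * x1 + w2 * x2)"
    by (simp_all add: algebra_simps)
  then have "ln (v1 * (w1 * x1 + w2 * x2)) \<le> ln (w1 * (v1 * x1 + v2 * x2))"
    "ln (w2 * (v1 * x1 + v2 * x2)) \<le> ln (v2 * (w1 * x1 + w2 * x2))"
    using pos assms by (auto simp: ln_le_cancel_iff)
  then show "ln v1 - ln w1 \<le> ln (v1 * x1 + v2 * x2) - ln (w1 * x1 + w2 * x2)"
    and "ln (v1 * x1 + v2 * x2) - ln (w1 * x1 + w2 * x2) \<le> ln v2 - ln w2"
    using pos[of v1 v2] pos[of w1 w2] assms by (simp_all add: ln_mult)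
qed

lemma ln_mediant_between:
  fixes x1 :: real
  assumes "0 < v1" "0 < v2" "0 < w1" "0 < w2" "0 \<le> x1" "0 \<le> x2" "0 < x1 + x2"
  shows "min (ln v1 - ln w1) (ln v2 - ln w2) \<le> ln (v1 * x1 + v2 * x2) - ln (w1 * x1 + w2 * x2)"
    and "ln (v1 * x1 + v2 * x2) - ln (w1 * x1 + w2 * x2) \<le> max (ln v1 - ln w1) (ln v2 - ln w2)"
  using ln_mediant_bounds[of v1 v2 w1 w2 x1 x2] ln_mediant_bounds[of v2 v1 w2 w1 x2 x1] assms
  by (auto simp: min_def max_def add.commute)

text \<open>Both differences of logarithms are logarithms of mediants, so they lie between the two
  numbers \<open>ln (v $ i) - ln (w $ i)\<close>; the length of that interval is Hilbert's distance
  of \<open>v\<close> and \<open>w\<close>.\<close>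

lemma ln_inner_cross_ratio:
  assumes "pos_vec v" "pos_vec w" "pos_vec x" "pos_vec y"
  shows "\<bar>(ln (v \<bullet> x) - ln (w \<bullet> x)) - (ln (v \<bullet> y) - ln (w \<bullet> y))\<bar> \<le> \<bar>log_slope v - log_slope w\<bar>"
proof -
  have p: "0 < v $ 1" "0 < v $ 2" "0 < w $ 1" "0 < w $ 2" "0 < x $ 1" "0 < x $ 2" "0 < y $ 1" "0 < y $ 2"
    using assms by (auto simp: pos_vec_def)
  show ?thesis unfolding inner_2 log_slope_def
    using ln_mediant_between[of "v $ 1" "v $ 2" "w $ 1" "w $ 2" "x $ 1" "x $ 2"]
      ln_mediant_between[of "v $ 1" "v $ 2" "w $ 1" "w $ 2" "y $ 1" "y $ 2"] p by linarith
qed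

text \<open>The slope of \<open>v v* M\<close> is a mediant of the slopes of the two rows of
  \<open>M\<close>, whatever \<open>v\<close> is; hence one bound for the whole quadrant.\<close>

lemma log_slope_image_bounded:
  assumes "pos_mat M"
  obtains D where "\<And>v. (\<And>i. 0 \<le> v $ i) \<Longrightarrow> v \<noteq> 0 \<Longrightarrow> \<bar>log_slope (v v* M)\<bar> \<le> D"
proof
  fix v :: "real^2" assume v: "\<And>i. 0 \<le> v $ i" "v \<noteq> 0"
  then have "0 < v $ 1 + v $ 2"
    by (metis (no_types, lifting) add_nonneg_eq_0_iff add_nonneg_nonneg exhaust_2 order_le_less vec_eq_iff zero_index)
  then show "\<bar>log_slope (v v* M)\<bar> \<le> \<bar>ln (M $ 1 $ 1) - ln (M $ 1 $ 2)\<bar> + \<bar>ln (M $ 2 $ 1) - ln (M $ 2 $ 2)\<bar>"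
    using ln_mediant_between[of "M $ 1 $ 1" "M $ 2 $ 1" "M $ 1 $ 2" "M $ 2 $ 2" "v $ 1" "v $ 2"] v assms
    by (simp add: log_slope_def vector_matrix_mult_2 pos_mat_def mult.commute)
qed

text \<open>In the coordinate \<open>s = log_slope v\<close> the action of \<open>M\<close> is the
  real function \<open>f\<close>, so a bound on its derivative is a Lipschitz constant for Hilbert's
  metric.\<close>

lemma contracts_pos_mat:
  assumes "pos_mat M"
  obtains k where "0 \<le> k" "k < 1" "contracts M k"
proof
  define a b c d where abcd: "a = M $ 1 $ 1" "b = M $ 1 $ 2" "c = M $ 2 $ 1" "d = M $ 2 $ 2"
  have pos: "0 < a" "0 < b" "0 < c" "0 < d" using assms by (auto simp: pos_mat_def abcd)
  \<comment> \<open>Obtained from the derivative of \<open>f\<close> by dropping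
    \<open>a * b * exp s * exp s + c * d\<close> from the expanded denominator. It need not be
    Birkhoff's optimal constant; all that counts is that it is below 1.\<close>
  define k where "k = \<bar>a * d - b * c\<bar> / (a * d + b * c)"
  have den: "0 < a * d + b * c" using pos by (simp add: add_pos_pos)
  show "0 \<le> k" unfolding k_def using den by simp
  have "\<bar>a * d - b * c\<bar> < a * d + b * c" using pos mult_pos_pos[of a d] mult_pos_pos[of b c] by linarith
  then show "k < 1" unfolding k_def using den by simp
  define f where "f s = ln (a * exp s + c) - ln (b * exp s + d)" for s
  define f' where "f' s = a * exp s / (a * exp s + c) - b * exp s / (b * exp s + d)" for s
  have p: "0 < a * exp s + c" "0 < b * exp s + d" for s using pos by (simp_all add: add_pos_pos)
  have deriv: "(f has_field_derivative f' s) (at s within UNIV)" for s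
    unfolding f_def f'_def using p[of s] by (auto intro!: derivative_eq_intros simp: field_simps)
  have bound: "norm (f' s) \<le> k" for s
  proof -
    have "f' s = exp s * (a * d - b * c) / ((a * exp s + c) * (b * exp s + d))"
      unfolding f'_def using p[of s] by (simp add: divide_simps) (simp add: algebra_simps)
    then have "norm (f' s) = exp s * \<bar>a * d - b * c\<bar> / ((a * exp s + c) * (b * exp s + d))"
      using p[of s] by (simp add: abs_mult)
    also have "\<dots> \<le> exp s * \<bar>a * d - b * c\<bar> / (exp s * (a * d + b * c))"
    proof (rule divide_left_mono)
      have "(a * exp s + c) * (b * exp s + d) - exp s * (a * d + b * c) = a * b * exp s * exp s + c * d"
        by (simp add: algebra_simps)
      also have "0 \<le> \<dots>" using pos by simp
      finally show "exp s * (a * d + b * c) \<le> (a * exp s + c) * (b * exp s + d)" by simp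
    qed (use pos p[of s] den in auto)
    also have "\<dots> = k" unfolding k_def by simp
    finally show ?thesis .
  qed
  have slope: "log_slope (v v* M) = f (log_slope v)" if "pos_vec v" for v
  proof -
    have v: "0 < v $ 1" "0 < v $ 2" using that by (auto simp: pos_vec_def)
    then have e: "exp (log_slope v) = v $ 1 / v $ 2" by (simp add: log_slope_def exp_diff)
    have "ln (x * exp (log_slope v) + y) = ln (v $ 1 * x + v $ 2 * y) - ln (v $ 2)" if "0 < x" "0 < y" for x y
    proof -
      have "x * exp (log_slope v) + y = (v $ 1 * x + v $ 2 * y) / v $ 2"
        unfolding e using v by (simp add: field_simps)
      then show ?thesis using v that by (simp add: ln_divide_pos add_pos_pos)
    qed
    then show ?thesis unfolding f_def using pos
      by (simp add: log_slope_def[of "v v* M"] vector_matrix_mult_2 abcd)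
  qed
  show "contracts M k" unfolding contracts_def
  proof (intro allI impI)
    fix v w assume vw: "pos_vec v" "pos_vec w"
    have "norm (f (log_slope v) - f (log_slope w)) \<le> k * norm (log_slope v - log_slope w)"
      using deriv bound by (intro field_differentiable_bound[of UNIV f f' k]) auto
    then show "\<bar>log_slope (v v* M) - log_slope (w v* M)\<bar> \<le> k * \<bar>log_slope v - log_slope w\<bar>"
      using vw by (simp add: slope)
  qed
qed

lemma contracts_mono: "contracts M k \<Longrightarrow> k \<le> l \<Longrightarrow> contracts M l"
  unfolding contracts_def by (meson abs_ge_zero mult_right_mono order_trans)

lemma contracts_mult:
  assumes "contracts M k" "contracts M' l" "0 \<le> l"
    and pos: "\<And>v. pos_vec v \<Longrightarrow> pos_vec (v v* M)"
  shows "contracts (M ** M') (k * l)"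
  unfolding contracts_def
proof (intro allI impI)
  fix v w assume vw: "pos_vec v" "pos_vec w"
  have "\<bar>log_slope (v v* M v* M') - log_slope (w v* M v* M')\<bar> \<le> l * \<bar>log_slope (v v* M) - log_slope (w v* M)\<bar>"
    using assms(2) vw pos unfolding contracts_def by blast
  also have "\<dots> \<le> l * (k * \<bar>log_slope v - log_slope w\<bar>)"
    using assms vw unfolding contracts_def by (intro mult_left_mono) auto
  finally show "\<bar>log_slope (v v* (M ** M')) - log_slope (w v* (M ** M'))\<bar> \<le> k * l * \<bar>log_slope v - log_slope w\<bar>"
    by (simp add: vector_matrix_mul_assoc algebra_simps)
qed

lemma contracts_id: "contracts (mat 1) 1"
  by (simp add: contracts_def)

section \<open>The entry sum as a norm on non-negative matrices\<close>

definition mat_sum :: "real^2^2 \<Rightarrow> real" where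
  "mat_sum M = M $ 1 $ 1 + M $ 1 $ 2 + M $ 2 $ 1 + M $ 2 $ 2"

definition nonneg_mat :: "real^2^2 \<Rightarrow> bool" where
  "nonneg_mat M \<longleftrightarrow> (\<forall>i j. 0 \<le> M $ i $ j)"

lemma matrix_mult_2: "(A ** B) $ i $ j = A $ i $ 1 * B $ 1 $ j + A $ i $ 2 * B $ 2 $ j" for A B :: "real^2^2"
  by (simp add: matrix_matrix_mult_def sum_2)

lemma nonneg_mat_mult: "nonneg_mat A \<Longrightarrow> nonneg_mat B \<Longrightarrow> nonneg_mat (A ** B)"
  by (auto simp: nonneg_mat_def matrix_mult_2 intro!: add_nonneg_nonneg)

lemma pos_mat_nonneg: "pos_mat M \<Longrightarrow> nonneg_mat M"
  by (auto simp: pos_mat_def nonneg_mat_def less_imp_le)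

lemma mat_sum_nonneg: "nonneg_mat A \<Longrightarrow> 0 \<le> mat_sum A"
  by (simp add: nonneg_mat_def mat_sum_def)

lemma nonneg_mat_entries:
  assumes "nonneg_mat A"
  shows "0 \<le> A $ 1 $ 1" "0 \<le> A $ 1 $ 2" "0 \<le> A $ 2 $ 1" "0 \<le> A $ 2 $ 2"
  using assms by (auto simp: nonneg_mat_def)

lemma mat_sum_mult_le:
  assumes "nonneg_mat A" "nonneg_mat B"
  shows "mat_sum (A ** B) \<le> mat_sum A * mat_sum B"
proof -
  note a = nonneg_mat_entries[OF assms(1)] and b = nonneg_mat_entries[OF assms(2)]
  have "0 \<le> (A $ 1 $ 1 + A $ 2 $ 1) * (B $ 2 $ 1 + B $ 2 $ 2) + (A $ 1 $ 2 + A $ 2 $ 2) * (B $ 1 $ 1 + B $ 1 $ 2)"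
    using a b by (intro add_nonneg_nonneg mult_nonneg_nonneg) auto
  then show ?thesis by (simp add: mat_sum_def matrix_mult_2 algebra_simps)
qed

text \<open>The entry sum of the product pairs the column sums of \<open>A\<close> with the row sums
  of \<open>C\<close> through \<open>B\<close>; putting \<open>c\<close> in place of every entry of
  \<open>B\<close> makes it factor.\<close>

lemma mat_sum_mult_ge:
  assumes "nonneg_mat A" "nonneg_mat B" "nonneg_mat C" "\<And>i j. c \<le> B $ i $ j" "0 \<le> c"
  shows "c * mat_sum A * mat_sum C \<le> mat_sum (A ** B ** C)"
proof -
  note a = nonneg_mat_entries[OF assms(1)] and cc = nonneg_mat_entries[OF assms(3)]
  have eq: "mat_sum (A ** B ** C) =
     (A $ 1 $ 1 + A $ 2 $ 1) * (B $ 1 $ 1 * (C $ 1 $ 1 + C $ 1 $ 2) + B $ 1 $ 2 * (C $ 2 $ 1 + C $ 2 $ 2))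
   + (A $ 1 $ 2 + A $ 2 $ 2) * (B $ 2 $ 1 * (C $ 1 $ 1 + C $ 1 $ 2) + B $ 2 $ 2 * (C $ 2 $ 1 + C $ 2 $ 2))"
    by (simp add: mat_sum_def matrix_mult_2 algebra_simps)
  have "c * mat_sum A * mat_sum C =
     (A $ 1 $ 1 + A $ 2 $ 1) * (c * (C $ 1 $ 1 + C $ 1 $ 2) + c * (C $ 2 $ 1 + C $ 2 $ 2))
   + (A $ 1 $ 2 + A $ 2 $ 2) * (c * (C $ 1 $ 1 + C $ 1 $ 2) + c * (C $ 2 $ 1 + C $ 2 $ 2))"
    by (simp add: mat_sum_def algebra_simps)
  also have "\<dots> \<le> mat_sum (A ** B ** C)" unfolding eq
    using a cc assms(4) by (intro add_mono mult_left_mono mult_right_mono) auto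
  finally show ?thesis .
qed

lemma norm_le_mat_sum:
  assumes "nonneg_mat A"
  shows "norm A \<le> mat_sum A" "mat_sum A \<le> 4 * norm A"
proof -
  have "norm A \<le> (\<Sum>i\<in>UNIV. norm (A $ i))" unfolding norm_vec_def by (rule L2_set_le_sum) auto
  also have "\<dots> \<le> (\<Sum>i\<in>UNIV. \<Sum>j\<in>UNIV. norm (A $ i $ j))"
    unfolding norm_vec_def[where 'a = real] by (intro sum_mono L2_set_le_sum) auto
  also have "\<dots> = mat_sum A" using assms by (simp add: sum_2 mat_sum_def nonneg_mat_def)
  finally show "norm A \<le> mat_sum A" .
  have "A $ i $ j \<le> norm A" for i j
    using component_le_norm_cart[of "A $ i" j] Finite_Cartesian_Product.norm_nth_le[of A i] by linarith
  from this[of 1 1] this[of 1 2] this[of 2 1] this[of 2 2]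
  show "mat_sum A \<le> 4 * norm A" unfolding mat_sum_def by linarith
qed

text \<open>Applying the eigenvector equation to the all-ones column shows that \<open>l\<close> is
  an average of the row sums with weights proportional to \<open>v\<close>; the bound on the slope
  keeps both weights at least \<open>1 / (1 + exp D)\<close>.\<close>

lemma spectral_radius_ge_mat_sum:
  assumes "pos_mat M" "pos_vec v" "v v* M = l *s v" "\<bar>log_slope v\<bar> \<le> D"
  shows "mat_sum M \<le> (1 + exp D) * l"
proof -
  have v: "0 < v $ 1" "0 < v $ 2" using assms by (auto simp: pos_vec_def)
  have "ln (v $ 1) \<le> ln (exp D * v $ 2)" "ln (v $ 2) \<le> ln (exp D * v $ 1)"
    using assms(4) v by (auto simp: log_slope_def ln_mult)
  then have c: "v $ 1 \<le> exp D * v $ 2" "v $ 2 \<le> exp D * v $ 1" using v by (auto simp: ln_le_cancel_iff)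
  note m = nonneg_mat_entries[OF pos_mat_nonneg[OF assms(1)]]
  let ?r = "\<lambda>i. M $ i $ 1 + M $ i $ 2"
  have "(v $ 1 + v $ 2) * l = v $ 1 * ?r 1 + v $ 2 * ?r 2"
    using assms(3) by (simp add: vec_eq_iff forall_2 vector_matrix_mult_2 algebra_simps)
  moreover have "(v $ 1 + v $ 2) * ?r 1 \<le> (1 + exp D) * v $ 1 * ?r 1"
    "(v $ 1 + v $ 2) * ?r 2 \<le> (1 + exp D) * v $ 2 * ?r 2"
    using c m by (intro mult_right_mono; simp add: algebra_simps)+
  ultimately have "(v $ 1 + v $ 2) * ?r 1 + (v $ 1 + v $ 2) * ?r 2 \<le> (1 + exp D) * ((v $ 1 + v $ 2) * l)"
    by (simp only: distrib_left mult.assoc)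
  then have "(v $ 1 + v $ 2) * mat_sum M \<le> (v $ 1 + v $ 2) * ((1 + exp D) * l)"
    by (simp add: mat_sum_def algebra_simps)
  then show ?thesis using v by simp
qed

section \<open>The joint spectral radius\<close>

text \<open>Fekete's lemma; the limit is the infimum of the quotients.\<close>

lemma subadditive_limit:
  fixes f :: "nat \<Rightarrow> real"
  assumes sub: "\<And>m n. f (m + n) \<le> f m + f n"
    and bdd: "\<And>n. n \<ge> 1 \<Longrightarrow> B \<le> f n / real n"
  obtains L where "(\<lambda>n. f n / real n) \<longlonglongrightarrow> L"
proof
  define L where "L = (INF n\<in>{1..}. f n / real n)"
  have bd: "bdd_below ((\<lambda>n. f n / real n) ` {1..})" using bdd by (intro bdd_belowI2) auto
  have lower: "L \<le> f n / real n" if "n \<ge> 1" for n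
    unfolding L_def using that bd by (intro cINF_lower) auto
  have upper: "\<forall>\<^sub>F n in sequentially. f n / real n < L + e" if "e > 0" for e
  proof -
    have "Inf ((\<lambda>n. f n / real n) ` {1..}) < L + e / 2" using that unfolding L_def by simp
    then obtain m where m: "m \<ge> 1" "f m / real m < L + e / 2"
      by (subst (asm) cInf_less_iff) (use bd in auto)
    \<comment> \<open>Absorbs what division by \<open>m\<close> with remainder leaves over: the
      value of \<open>f\<close> at the remainder, and the fraction of \<open>f m\<close> by which
      the full blocks fall short of \<open>n / m\<close>.\<close>
    define C where "C = (\<Sum>j<m. \<bar>f j\<bar>) + \<bar>f m\<bar>"
    have mult: "f (k * m + j) \<le> real k * f m + f j" for k j
    proof (induction k)
      case (Suc k)
      have "f (m + (k * m + j)) \<le> f m + f (k * m + j)" by (rule sub)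
      then show ?case using Suc by (simp add: algebra_simps)
    qed simp
    have bound: "f n / real n \<le> f m / real m + C / real n" if "n \<ge> 1" for n
    proof -
      let ?k = "n div m" and ?j = "n mod m"
      have j: "?j < m" using m by simp
      have n: "real n = real ?k * real m + real ?j" by (metis div_mult_mod_eq of_nat_add of_nat_mult)
      have 1: "f n \<le> real ?k * f m + f ?j" using mult[of ?k ?j] by simp
      have 2: "real ?k * f m = real n * (f m / real m) - real ?j / real m * f m"
        unfolding n using m by (simp add: field_simps)
      have "\<bar>real ?j / real m * f m\<bar> \<le> 1 * \<bar>f m\<bar>"
        unfolding abs_mult using j m by (intro mult_right_mono) auto
      moreover have "\<bar>f ?j\<bar> \<le> (\<Sum>j<m. \<bar>f j\<bar>)" using j by (intro member_le_sum) auto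
      ultimately have "f n \<le> real n * (f m / real m) + C" using 1 2 unfolding C_def by linarith
      then show ?thesis using that by (simp add: field_simps)
    qed
    have "(\<lambda>n. f m / real m + C / real n) \<longlonglongrightarrow> f m / real m + 0"
      by (intro tendsto_intros lim_const_over_n)
    then have "\<forall>\<^sub>F n in sequentially. f m / real m + C / real n < L + e"
      using m that by (intro order_tendstoD) auto
    then show ?thesis using eventually_ge_at_top[of 1]
    proof eventually_elim
      case (elim n)
      then show ?case using bound[of n] by linarith
    qed
  qed
  show "(\<lambda>n. f n / real n) \<longlonglongrightarrow> L"
  proof (rule order_tendstoI)
    fix a assume "a < L"
    show "\<forall>\<^sub>F n in sequentially. a < f n / real n"
      using eventually_ge_at_top[of 1]
    proof eventually_elim
      case (elim n)
      then show ?case using lower[of n] \<open>a < L\<close> by linarith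
    qed
  next
    fix a assume "L < a"
    then show "\<forall>\<^sub>F n in sequentially. f n / real n < a" using upper[of "a - L"] by simp
  qed
qed

text \<open>Constant factors disappear under the \<open>n\<close>-th root. This is what allows the
  Frobenius norm to be exchanged for the entry sum.\<close>

lemma tendsto_root_between:
  fixes b c :: "nat \<Rightarrow> real"
  assumes lim: "(\<lambda>n. root n (c n)) \<longlonglongrightarrow> L"
    and "\<And>n. 0 \<le> c n" "\<And>n. c n / K \<le> b n" "\<And>n. b n \<le> K * c n" "0 < K"
  shows "(\<lambda>n. root n (b n)) \<longlonglongrightarrow> L"
proof (rule tendsto_sandwich)
  have rK: "(\<lambda>n. root n K) \<longlonglongrightarrow> 1" "(\<lambda>n. root n (1 / K)) \<longlonglongrightarrow> 1"
    using assms(5) by (auto intro: LIMSEQ_root_const)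
  show "(\<lambda>n. root n (1 / K) * root n (c n)) \<longlonglongrightarrow> L" "(\<lambda>n. root n K * root n (c n)) \<longlonglongrightarrow> L"
    using tendsto_mult[OF rK(1) lim] tendsto_mult[OF rK(2) lim] by simp_all
  show "\<forall>\<^sub>F n in sequentially. root n (1 / K) * root n (c n) \<le> root n (b n)"
    using eventually_gt_at_top[of 0]
  proof eventually_elim
    case (elim n)
    have "root n (1 / K * c n) \<le> root n (b n)" using assms(3)[of n] elim by simp
    then show ?case by (simp only: real_root_mult)
  qed
  show "\<forall>\<^sub>F n in sequentially. root n (b n) \<le> root n K * root n (c n)"
    using eventually_gt_at_top[of 0]
  proof eventually_elim
    case (elim n)
    have "root n (b n) \<le> root n (K * c n)" using assms(4)[of n] elim by simp
    then show ?case by (simp add: real_root_mult)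
  qed
qed

section \<open>Matrix products along words\<close>

lemma rev_prod_append: "rev_prod (Ms @ Ns) = rev_prod Ns ** rev_prod Ms"
  by (induction Ms) (simp_all add: matrix_mul_assoc)

lemma word_matrix_append: "word_matrix A0 A1 \<alpha> (u @ v) = word_matrix A0 A1 \<alpha> v ** word_matrix A0 A1 \<alpha> u"
  by (simp add: word_matrix_def rev_prod_append)

lemma word_matrix_Nil: "word_matrix A0 A1 \<alpha> [] = mat 1"
  by (simp add: word_matrix_def)

lemma word_matrix_Cons: "word_matrix A0 A1 \<alpha> (b # u) = word_matrix A0 A1 \<alpha> u ** letter_matrix A0 A1 \<alpha> b"
  by (simp add: word_matrix_def)

lemma word_matrix_scale:
  "word_matrix A0 A1 \<alpha> u = \<alpha> ^ count_list u True *\<^sub>R word_matrix A0 A1 1 u"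
proof (induction u)
  case (Cons b u)
  show ?case unfolding word_matrix_Cons Cons.IH
    by (cases b) (simp_all add: letter_matrix_def vec_eq_iff matrix_mult_2 algebra_simps)
qed (simp add: word_matrix_Nil)

lemma mat_sum_scaleR: "mat_sum (c *\<^sub>R M) = c * mat_sum M"
  by (simp add: mat_sum_def algebra_simps)

lemma eigenvalue_le_mat_sum:
  assumes "nonneg_mat M" "pos_vec x" "M *v x = l *s x"
  shows "l \<le> mat_sum M"
proof -
  note m = nonneg_mat_entries[OF assms(1)]
  have x: "0 < x $ 1" "0 < x $ 2" using assms by (auto simp: pos_vec_def)
  have "l * x $ 1 = M $ 1 $ 1 * x $ 1 + M $ 1 $ 2 * x $ 2" "l * x $ 2 = M $ 2 $ 1 * x $ 1 + M $ 2 $ 2 * x $ 2"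
    using assms(3) by (simp_all add: vec_eq_iff matrix_vector_mult_2)
  moreover have "0 \<le> M $ 1 $ 1 * x $ 2" "0 \<le> M $ 1 $ 2 * x $ 1" "0 \<le> M $ 2 $ 1 * x $ 2" "0 \<le> M $ 2 $ 2 * x $ 1"
    using m x by simp_all
  ultimately have "l * (x $ 1 + x $ 2) \<le> mat_sum M * (x $ 1 + x $ 2)"
    by (simp add: mat_sum_def algebra_simps)
  then show ?thesis using x by simp
qed

lemma word_power_eigenvector:
  fixes x :: "real^2"
  assumes "word_matrix A0 A1 \<alpha> u *v x = l *s x"
  shows "word_matrix A0 A1 \<alpha> (word_power u k) *v x = l ^ k *s x"
proof (induction k)
  case (Suc k)
  then show ?case using assms
    by (simp add: word_matrix_append flip: matrix_vector_mul_assoc)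
       (simp add: vector_scalar_commute vector_smult_assoc)
qed (simp add: word_matrix_Nil)

lemma finite_words: "finite {u :: word. length u = n}"
  using finite_lists_length_eq[of "UNIV :: bool set" n] by simp

lemma words_nonempty: "{u :: word. length u = n} \<noteq> {}"
  using length_replicate[of n False] by blast

lemma count_list_map_upt: "count_list (map x [0..<n]) True = card {i\<in>{1..n}. x (i - 1)}"
proof (induction n)
  case (Suc n)
  have "{i\<in>{1..Suc n}. x (i - 1)} = {i\<in>{1..n}. x (i - 1)} \<union> (if x n then {Suc n} else {})"
    by (auto simp: le_Suc_eq)
  then have "card {i\<in>{1..Suc n}. x (i - 1)} = card {i\<in>{1..n}. x (i - 1)} + of_bool (x n)"
    by (auto simp: card_insert_if)
  then show ?case using Suc by simp
qed simp

locale sturmian_pair =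
  fixes A0 A1 :: "real^2^2" and r :: "real \<Rightarrow> real"
  assumes technical: "technical_hypotheses A0 A1"
    and sturmian: "sturmian_hypothesis A0 A1 r"
begin

abbreviation "W \<equiv> word_matrix A0 A1"
abbreviation "jsr \<equiv> pair_jsr A0 A1"

definition max_sum :: "real \<Rightarrow> nat \<Rightarrow> real" where
  "max_sum \<alpha> n = Max ((\<lambda>u. mat_sum (W \<alpha> u)) ` {u. length u = n})"

lemma nonneg_A: "nonneg_mat A0" "nonneg_mat A1" and trace_A: "0 < trace A0" "0 < trace A1"
  using technical by (auto simp: technical_hypotheses_def nonneg_mat_def)

lemma nonneg_W: "0 \<le> \<alpha> \<Longrightarrow> nonneg_mat (W \<alpha> u)"
proof (induction u)
  case Nil
  show ?case by (auto simp: word_matrix_Nil nonneg_mat_def mat_def)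
next
  case (Cons b u)
  have "nonneg_mat (letter_matrix A0 A1 \<alpha> b)" using nonneg_A Cons.prems
    by (auto simp: letter_matrix_def nonneg_mat_def)
  then show ?case using Cons by (auto simp: word_matrix_Cons intro!: nonneg_mat_mult)
qed

lemma pos_W: "set u = {False, True} \<Longrightarrow> pos_mat (W 1 u)"
proof -
  assume u: "set u = {False, True}"
  have "u \<noteq> replicate n b" for n b
  proof
    assume "u = replicate n b"
    then have "set u \<subseteq> {b}" by (simp add: set_replicate_conv_if)
    then show False using u by (cases b) simp_all
  qed
  moreover have "u \<noteq> []" using u by (cases u) simp_all
  moreover have "\<forall>u. u \<noteq> [] \<and> (\<nexists>n. u = replicate n True) \<and> (\<nexists>n. u = replicate n False) \<longrightarrow>
      (\<forall>i j. 0 < W 1 u $ i $ j)"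
    using technical unfolding technical_hypotheses_def by (elim conjE)
  ultimately show ?thesis unfolding pos_mat_def by simp
qed

lemma mat_sum_le_max: "mat_sum (W \<alpha> u) \<le> max_sum \<alpha> (length u)"
  unfolding max_sum_def by (intro Max_ge finite_imageI finite_words) auto

lemma max_sum_attained: obtains u where "length u = n" "mat_sum (W \<alpha> u) = max_sum \<alpha> n"
proof -
  have "max_sum \<alpha> n \<in> (\<lambda>u. mat_sum (W \<alpha> u)) ` {u. length u = n}"
    unfolding max_sum_def by (intro Max_in finite_imageI finite_words) (use words_nonempty in auto)
  then show ?thesis using that by auto
qed

lemma max_sum_submult:
  assumes "0 \<le> \<alpha>"
  shows "max_sum \<alpha> (m + n) \<le> max_sum \<alpha> m * max_sum \<alpha> n"
proof -
  obtain u where u: "length u = m + n" "mat_sum (W \<alpha> u) = max_sum \<alpha> (m + n)" by (rule max_sum_attained)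
  have "W \<alpha> u = W \<alpha> (drop m u) ** W \<alpha> (take m u)" by (simp flip: word_matrix_append)
  then have "max_sum \<alpha> (m + n) \<le> mat_sum (W \<alpha> (drop m u)) * mat_sum (W \<alpha> (take m u))"
    using mat_sum_mult_le[OF nonneg_W[OF assms] nonneg_W[OF assms], of "drop m u" "take m u"] u by simp
  also have "\<dots> \<le> max_sum \<alpha> n * max_sum \<alpha> m"
    using mat_sum_le_max[of \<alpha> "drop m u"] mat_sum_le_max[of \<alpha> "take m u"] u assms
      mat_sum_nonneg[OF nonneg_W] by (intro mult_mono) (auto intro: order_trans)
  finally show ?thesis by (simp add: mult.commute)
qed

lemma replicate_lower:
  assumes "0 \<le> \<alpha>"
  shows "letter_matrix A0 A1 \<alpha> b $ i $ i ^ n \<le> mat_sum (W \<alpha> (replicate n b))"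
proof -
  let ?M = "letter_matrix A0 A1 \<alpha> b"
  have nn: "nonneg_mat ?M" using nonneg_A assms by (auto simp: letter_matrix_def nonneg_mat_def)
  have "?M $ i $ i ^ n \<le> W \<alpha> (replicate n b) $ i $ i"
  proof (induction n)
    case 0
    show ?case by (simp add: word_matrix_Nil mat_def)
  next
    case (Suc n)
    have "?M $ i $ i ^ Suc n \<le> W \<alpha> (replicate n b) $ i $ i * ?M $ i $ i"
      using Suc nn by (simp add: mult.commute mult_left_mono nonneg_mat_def)
    also have "\<dots> \<le> W \<alpha> (replicate (Suc n) b) $ i $ i"
      using nn nonneg_W[OF assms, of "replicate n b"] exhaust_2[of i]
      by (auto simp: word_matrix_Cons matrix_mult_2 nonneg_mat_def mult.commute)
    finally show ?case .
  qed
  also have "\<dots> \<le> mat_sum (W \<alpha> (replicate n b))"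
    using nonneg_mat_entries[OF nonneg_W[OF assms, of "replicate n b"]] exhaust_2[of i]
    by (auto simp: mat_sum_def)
  finally show ?thesis .
qed

text \<open>A positive trace provides a positive diagonal entry, and the products along
  \<open>0^n\<close> or \<open>1^n\<close> grow at least like its powers. Uniformity in
  \<open>\<alpha>\<close> matters: the first bound keeps the joint spectral radius away from 0, the
  second makes it grow at least linearly in \<open>\<alpha>\<close>.\<close>

lemma exponential_lower:
  obtains c0 c1 where "0 < c0" "0 < c1"
    "\<And>\<alpha> n. 0 \<le> \<alpha> \<Longrightarrow> c0 ^ n \<le> max_sum \<alpha> n"
    "\<And>\<alpha> n. 0 \<le> \<alpha> \<Longrightarrow> (\<alpha> * c1) ^ n \<le> max_sum \<alpha> n"
proof -
  have "\<exists>i. 0 < A $ i $ i" if "0 < trace A" for A :: "real^2^2"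
    using that by (auto simp: trace_def sum_2) (smt (verit))
  then obtain i j where ij: "0 < A0 $ i $ i" "0 < A1 $ j $ j" using trace_A by metis
  show ?thesis
  proof (rule that[OF ij])
    fix \<alpha> :: real and n :: nat assume "0 \<le> \<alpha>"
    show "(A0 $ i $ i) ^ n \<le> max_sum \<alpha> n"
      using replicate_lower[OF \<open>0 \<le> \<alpha>\<close>, of False i n] mat_sum_le_max[of \<alpha> "replicate n False"]
      by (simp add: letter_matrix_def)
    show "(\<alpha> * A1 $ j $ j) ^ n \<le> max_sum \<alpha> n"
      using replicate_lower[OF \<open>0 \<le> \<alpha>\<close>, of True j n] mat_sum_le_max[of \<alpha> "replicate n True"]
      by (simp add: letter_matrix_def)
  qed
qed

lemma max_sum_pos: "0 \<le> \<alpha> \<Longrightarrow> 0 < max_sum \<alpha> n"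
  by (rule exponential_lower) (metis less_le_trans zero_less_power)

text \<open>The definition uses \<open>lim\<close>, which says nothing until convergence is known.
  Fekete's lemma supplies it for the entry sums, and the factor 4 between entry sum and norm
  vanishes under the root.\<close>

lemma jsr_limit:
  assumes "0 \<le> \<alpha>"
  shows "(\<lambda>n. root n (max_sum \<alpha> n)) \<longlonglongrightarrow> jsr \<alpha>"
proof -
  obtain c where c: "0 < c" "\<And>n. c ^ n \<le> max_sum \<alpha> n"
    using exponential_lower assms by metis
  note pos = max_sum_pos[OF assms]
  obtain L where "(\<lambda>n. ln (max_sum \<alpha> n) / real n) \<longlonglongrightarrow> L"
  proof (rule subadditive_limit)
    show "ln (max_sum \<alpha> (m + n)) \<le> ln (max_sum \<alpha> m) + ln (max_sum \<alpha> n)" for m n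
      using max_sum_submult[OF assms, of m n] pos by (simp flip: ln_mult_pos add: ln_le_cancel_iff)
    show "ln c \<le> ln (max_sum \<alpha> n) / real n" if "n \<ge> 1" for n
    proof -
      have "ln (c ^ n) \<le> ln (max_sum \<alpha> n)" using c pos by (subst ln_le_cancel_iff) auto
      then show ?thesis using c that by (simp add: ln_realpow field_simps)
    qed
  qed
  then have "(\<lambda>n. exp (ln (max_sum \<alpha> n) / real n)) \<longlonglongrightarrow> exp L" by (rule tendsto_exp)
  then have lim: "(\<lambda>n. root n (max_sum \<alpha> n)) \<longlonglongrightarrow> exp L"
  proof (rule Lim_transform_eventually)
    show "\<forall>\<^sub>F n in sequentially. exp (ln (max_sum \<alpha> n) / real n) = root n (max_sum \<alpha> n)"
      using eventually_gt_at_top[of 0]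
    proof eventually_elim
      case (elim n)
      then show ?case using pos[of n] by (simp add: root_powr_inverse powr_def)
    qed
  qed
  define G where "G n = Max {root n (norm (rev_prod Bs)) | Bs. length Bs = n \<and> set Bs \<subseteq> {A0, \<alpha> *\<^sub>R A1}}" for n
  have words: "{root n (norm (rev_prod Bs)) | Bs. length Bs = n \<and> set Bs \<subseteq> {A0, \<alpha> *\<^sub>R A1}}
    = (\<lambda>u. root n (norm (W \<alpha> u))) ` {u. length u = n}" (is "?L = ?R") for n
  proof
    show "?R \<subseteq> ?L"
    proof clarify
      fix u :: word
      show "\<exists>Bs. root (length u) (norm (W \<alpha> u)) = root (length u) (norm (rev_prod Bs)) \<and> length Bs = length u \<and> set Bs \<subseteq> {A0, \<alpha> *\<^sub>R A1}"
        by (intro exI[of _ "map (letter_matrix A0 A1 \<alpha>) u"]) (auto simp: word_matrix_def letter_matrix_def)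
    qed
    have "\<exists>u. Bs = map (letter_matrix A0 A1 \<alpha>) u" if "set Bs \<subseteq> {A0, \<alpha> *\<^sub>R A1}" for Bs
    proof -
      have "set Bs \<subseteq> range (letter_matrix A0 A1 \<alpha>)"
      proof
        fix B assume "B \<in> set Bs"
        then have "B = letter_matrix A0 A1 \<alpha> False \<or> B = letter_matrix A0 A1 \<alpha> True"
          using that by (auto simp: letter_matrix_def)
        then show "B \<in> range (letter_matrix A0 A1 \<alpha>)" by auto
      qed
      then show ?thesis by (metis ex_map_conv rangeE subsetD)
    qed
    then show "?L \<subseteq> ?R" by (fastforce simp: word_matrix_def)
  qed
  have G: "root n (max_sum \<alpha> n / 4) \<le> G n \<and> G n \<le> root n (max_sum \<alpha> n)" if "n > 0" for n
  proof
    have fin: "finite ((\<lambda>u. root n (norm (W \<alpha> u))) ` {u. length u = n})" by (intro finite_imageI finite_words)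
    show "G n \<le> root n (max_sum \<alpha> n)" unfolding G_def words
    proof (rule Max.boundedI[OF fin])
      fix y assume "y \<in> (\<lambda>u. root n (norm (W \<alpha> u))) ` {u. length u = n}"
      then obtain u where u: "length u = n" "y = root n (norm (W \<alpha> u))" by auto
      have "norm (W \<alpha> u) \<le> max_sum \<alpha> n"
        using norm_le_mat_sum(1)[OF nonneg_W[OF assms]] mat_sum_le_max[of \<alpha> u] u by (metis order_trans)
      then show "y \<le> root n (max_sum \<alpha> n)" using u that by simp
    qed (use words_nonempty in auto)
    obtain u where u: "length u = n" "mat_sum (W \<alpha> u) = max_sum \<alpha> n" by (rule max_sum_attained)
    have "root n (max_sum \<alpha> n / 4) \<le> root n (norm (W \<alpha> u))"
      using norm_le_mat_sum(2)[OF nonneg_W[OF assms], of u] u that by simp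
    also have "\<dots> \<le> G n" unfolding G_def words using u by (intro Max_ge[OF fin]) auto
    finally show "root n (max_sum \<alpha> n / 4) \<le> G n" .
  qed
  have lim4: "(\<lambda>n. root n (max_sum \<alpha> n / 4)) \<longlonglongrightarrow> exp L"
    by (rule tendsto_root_between[OF lim, of 4]) (use pos in \<open>auto simp: less_imp_le\<close>)
  have ev: "\<forall>\<^sub>F n in sequentially. root n (max_sum \<alpha> n / 4) \<le> G n \<and> G n \<le> root n (max_sum \<alpha> n)"
    using G by (intro eventually_mono[OF eventually_gt_at_top[of 0]])
  have "G \<longlonglongrightarrow> exp L"
    by (rule tendsto_sandwich[OF _ _ lim4 lim]) (use ev in \<open>auto elim: eventually_mono\<close>)
  then have "jsr \<alpha> = exp L" unfolding pair_jsr_def joint_spectral_radius_def G_def by (rule limI)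
  then show ?thesis using lim by simp
qed

text \<open>The hypothesis is used along the multiples of \<open>m\<close>. It serves alike for the
  eigenvalues of a word and for the supermultiplicative estimate of \<open>max_sum\<close>.\<close>

lemma power_le_jsr:
  assumes "0 \<le> \<alpha>" "0 < m" "\<And>k. x ^ k \<le> max_sum \<alpha> (k * m)" "0 \<le> x"
  shows "x \<le> jsr \<alpha> ^ m"
proof -
  have "(\<lambda>k. root (m * Suc k) (max_sum \<alpha> (m * Suc k))) \<longlonglongrightarrow> jsr \<alpha>"
    using LIMSEQ_subseq_LIMSEQ[OF jsr_limit[OF assms(1)], of "\<lambda>k. m * Suc k"] assms(2)
    by (simp add: o_def strict_mono_def)
  then have "(\<lambda>k. root (m * Suc k) (max_sum \<alpha> (m * Suc k)) ^ m) \<longlonglongrightarrow> jsr \<alpha> ^ m"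
    by (rule tendsto_power)
  moreover have "x \<le> root (m * Suc k) (max_sum \<alpha> (m * Suc k)) ^ m" for k
  proof -
    have "x ^ Suc k \<le> max_sum \<alpha> (m * Suc k)" using assms(3)[of "Suc k"] by (simp add: mult.commute)
    then have "root (Suc k) (x ^ Suc k) \<le> root (Suc k) (max_sum \<alpha> (m * Suc k))" by (intro real_root_le_mono) auto
    then have "x \<le> root (Suc k) (max_sum \<alpha> (m * Suc k))" using assms(4) by (simp add: real_root_power_cancel del: power_Suc)
    also have "\<dots> = root (m * Suc k) (max_sum \<alpha> (m * Suc k)) ^ m"
      unfolding real_root_mult_exp using assms(2) max_sum_pos[OF assms(1), of "m * Suc k"]
      by (simp add: real_root_ge_zero less_imp_le)
    finally show ?thesis .
  qed
  ultimately show ?thesis by (intro LIMSEQ_le_const) auto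
qed

lemma jsr_lower:
  obtains c0 c1 where "0 < c0" "0 < c1" "\<And>\<alpha>. 0 \<le> \<alpha> \<Longrightarrow> c0 \<le> jsr \<alpha>" "\<And>\<alpha>. 0 \<le> \<alpha> \<Longrightarrow> \<alpha> * c1 \<le> jsr \<alpha>"
proof -
  obtain c0 c1 where c: "0 < c0" "0 < c1"
    "\<And>\<alpha> n. 0 \<le> \<alpha> \<Longrightarrow> c0 ^ n \<le> max_sum \<alpha> n"
    "\<And>\<alpha> n. 0 \<le> \<alpha> \<Longrightarrow> (\<alpha> * c1) ^ n \<le> max_sum \<alpha> n"
    using exponential_lower by metis
  show ?thesis
  proof (rule that[OF c(1,2)])
    fix \<alpha> :: real assume "0 \<le> \<alpha>"
    then show "c0 \<le> jsr \<alpha>" using power_le_jsr[of \<alpha> 1 c0] c by simp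
    show "\<alpha> * c1 \<le> jsr \<alpha>" using power_le_jsr[of \<alpha> 1 "\<alpha> * c1"] c \<open>0 \<le> \<alpha>\<close> by simp
  qed
qed

lemma jsr_pos: "0 \<le> \<alpha> \<Longrightarrow> 0 < jsr \<alpha>"
  by (rule jsr_lower) (metis less_le_trans)

lemma eigenvalue_le_jsr:
  assumes "0 \<le> \<alpha>" "u \<noteq> []" "pos_vec x" "W \<alpha> u *v x = l *s x" "0 \<le> l"
  shows "l \<le> jsr \<alpha> ^ length u"
proof (rule power_le_jsr)
  show "l ^ k \<le> max_sum \<alpha> (k * length u)" for k
    using eigenvalue_le_mat_sum[OF nonneg_W[OF assms(1)] assms(3) word_power_eigenvector[OF assms(4)], of k]
      mat_sum_le_max[of \<alpha> "word_power u k"] by simp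
qed (use assms in auto)

text \<open>Inserting the word \<open>01\<close>, whose matrix is positive, between two words costs only a constant
  factor; this supermultiplicativity replaces the extremal norm of an irreducible pair.\<close>

lemma max_sum_upper:
  assumes "0 < \<alpha>"
  obtains C where "0 < C" "\<And>n. max_sum \<alpha> n \<le> C * jsr \<alpha> ^ n"
proof -
  let ?V = "W \<alpha> [False, True]"
  have "pos_mat (W 1 [False, True])" by (rule pos_W) auto
  then have V: "pos_mat ?V" using assms word_matrix_scale[of A0 A1 \<alpha> "[False, True]"] by (simp add: pos_mat_def)
  define c where "c = min (min (?V $ 1 $ 1) (?V $ 1 $ 2)) (min (?V $ 2 $ 1) (?V $ 2 $ 2))"
  have c: "0 < c" using V by (simp add: c_def pos_mat_def)
  have cV: "c \<le> ?V $ i $ j" for i j using exhaust_2[of i] exhaust_2[of j] by (auto simp: c_def)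
  have super: "c * max_sum \<alpha> m * max_sum \<alpha> n \<le> max_sum \<alpha> (n + 2 + m)" for m n
  proof -
    obtain u where u: "length u = m" "mat_sum (W \<alpha> u) = max_sum \<alpha> m" by (rule max_sum_attained)
    obtain v where v: "length v = n" "mat_sum (W \<alpha> v) = max_sum \<alpha> n" by (rule max_sum_attained)
    have "c * mat_sum (W \<alpha> u) * mat_sum (W \<alpha> v) \<le> mat_sum (W \<alpha> u ** ?V ** W \<alpha> v)"
      using assms c cV by (intro mat_sum_mult_ge nonneg_W) auto
    also have "W \<alpha> u ** ?V ** W \<alpha> v = W \<alpha> (v @ [False, True] @ u)"
      by (simp only: word_matrix_append matrix_mul_assoc)
    also have "mat_sum \<dots> \<le> max_sum \<alpha> (n + 2 + m)"
      using mat_sum_le_max[of \<alpha> "v @ [False, True] @ u"] u v by (simp add: add.commute add.left_commute)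
    finally show ?thesis using u v by simp
  qed
  have "c * max_sum \<alpha> n \<le> jsr \<alpha> ^ (n + 2)" for n
  proof (rule power_le_jsr)
    have x: "0 \<le> c * max_sum \<alpha> n" using c max_sum_pos[of \<alpha> n] assms by simp
    show "(c * max_sum \<alpha> n) ^ k \<le> max_sum \<alpha> (k * (n + 2))" for k
    proof (induction k)
      case 0
      show ?case using mat_sum_le_max[of \<alpha> "[]"] by (simp add: word_matrix_Nil mat_sum_def mat_def)
    next
      case (Suc k)
      have "(c * max_sum \<alpha> n) ^ Suc k \<le> c * max_sum \<alpha> n * max_sum \<alpha> (k * (n + 2))"
        using Suc x by (simp add: mult_left_mono)
      also have "\<dots> \<le> max_sum \<alpha> (k * (n + 2) + 2 + n)" by (rule super)
      finally show ?case by (simp add: algebra_simps)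
    qed
    show "0 \<le> c * max_sum \<alpha> n" by (rule x)
  qed (use assms in auto)
  then have "max_sum \<alpha> n \<le> jsr \<alpha> ^ 2 / c * jsr \<alpha> ^ n" for n
    using c by (simp add: field_simps power2_eq_square)
  moreover have "0 < jsr \<alpha> ^ 2 / c" using c jsr_pos[of \<alpha>] assms by simp
  ultimately show ?thesis using that by blast
qed

lemma weakly_extremal_iff:
  assumes "0 \<le> \<alpha>"
  shows "weakly_extremal A0 A1 \<alpha> x \<longleftrightarrow> (\<lambda>n. root n (mat_sum (W \<alpha> (map x [0..<n])))) \<longlonglongrightarrow> jsr \<alpha>"
proof
  note b = norm_le_mat_sum[OF nonneg_W[OF assms]]
  {
    assume "weakly_extremal A0 A1 \<alpha> x"
    then have "(\<lambda>n. root n (norm (W \<alpha> (map x [0..<n])))) \<longlonglongrightarrow> jsr \<alpha>" by (simp add: weakly_extremal_def)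
    then show "(\<lambda>n. root n (mat_sum (W \<alpha> (map x [0..<n])))) \<longlonglongrightarrow> jsr \<alpha>"
    proof (rule tendsto_root_between[where K = 4])
      fix n
      show "norm (W \<alpha> (map x [0..<n])) / 4 \<le> mat_sum (W \<alpha> (map x [0..<n]))"
        using b(1)[of "map x [0..<n]"] norm_ge_zero[of "W \<alpha> (map x [0..<n])"] by linarith
    qed (use b in auto)
  }
  {
    assume "(\<lambda>n. root n (mat_sum (W \<alpha> (map x [0..<n])))) \<longlonglongrightarrow> jsr \<alpha>"
    then have "(\<lambda>n. root n (norm (W \<alpha> (map x [0..<n])))) \<longlonglongrightarrow> jsr \<alpha>"
    proof (rule tendsto_root_between[where K = 4])
      fix n
      show "norm (W \<alpha> (map x [0..<n])) \<le> 4 * mat_sum (W \<alpha> (map x [0..<n]))"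
        using b(1)[of "map x [0..<n]"] norm_ge_zero[of "W \<alpha> (map x [0..<n])"] by linarith
      show "mat_sum (W \<alpha> (map x [0..<n])) / 4 \<le> norm (W \<alpha> (map x [0..<n]))"
        using b(2)[of "map x [0..<n]"] by linarith
    qed (use mat_sum_nonneg[OF nonneg_W[OF assms]] in auto)
    then show "weakly_extremal A0 A1 \<alpha> x" by (simp add: weakly_extremal_def)
  }
qed

end

section \<open>The ratio function\<close>

text \<open>Koenig's lemma for the binary tree of words all of whose prefixes satisfy
  \<open>P\<close>.\<close>

lemma koenig_words:
  assumes ex: "\<And>n. \<exists>u :: word. length u = n \<and> (\<forall>i\<le>n. P (take i u))"
  obtains x where "\<And>n. P (map x [0..<n])"
proof -
  \<comment> \<open>\<open>Q v\<close> says that \<open>v\<close> has admissible extensions of every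
    length, so that it can begin an infinite branch.\<close>
  define Q where "Q v \<longleftrightarrow> (\<forall>n\<ge>length v. \<exists>u :: word. length u = n \<and> take (length v) u = v \<and> (\<forall>i\<le>n. P (take i u)))" for v
  have "\<exists>b. Q (v @ [b])" if "Q v" for v
  proof (rule ccontr)
    assume "\<not> ?thesis"
    then have "\<forall>b. \<exists>n\<ge>Suc (length v). \<not> (\<exists>u :: word. length u = n \<and> take (Suc (length v)) u = v @ [b] \<and> (\<forall>i\<le>n. P (take i u)))"
      by (simp add: Q_def)
    then obtain m where m: "\<And>b. Suc (length v) \<le> m b"
      "\<And>b. \<not> (\<exists>u :: word. length u = m b \<and> take (Suc (length v)) u = v @ [b] \<and> (\<forall>i\<le>m b. P (take i u)))"
      by metis
    \<comment> \<open>Beyond both lengths neither one-letter extension of \<open>v\<close> can be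
      continued, yet \<open>Q v\<close> provides an admissible word that long.\<close>
    define N where "N = max (m False) (m True)"
    have mN: "m b \<le> N" for b by (cases b) (auto simp: N_def)
    then have "length v < N" using m(1)[of True] by (metis Suc_le_lessD le_trans)
    with that obtain u :: word where u: "length u = N" "take (length v) u = v" "\<forall>i\<le>N. P (take i u)"
      unfolding Q_def by (meson less_imp_le)
    define b where "b = u ! length v"
    have "take (Suc (length v)) u = v @ [b]"
      using u \<open>length v < N\<close> by (simp add: take_Suc_conv_app_nth b_def)
    then have "take (Suc (length v)) (take (m b) u) = v @ [b]" using m(1)[of b] by (simp add: min_def)
    moreover have "length (take (m b) u) = m b" using u mN[of b] by simp
    moreover have "\<forall>i\<le>m b. P (take i (take (m b) u))" using u(3) mN[of b] by (simp add: min_def)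
    ultimately show False using m(2)[of b] by blast
  qed
  then have step: "\<exists>v'. (length v' = Suc n \<and> Q v') \<and> (\<exists>b. v' = v @ [b])" if "length v = n \<and> Q v" for v n
    using that by (metis length_append_singleton)
  have "\<exists>v. length v = 0 \<and> Q v" using ex by (intro exI[of _ "[]"]) (simp add: Q_def)
  from dependent_nat_choice[of "\<lambda>n v. length v = n \<and> Q v" "\<lambda>n v v'. \<exists>b. v' = v @ [b]", OF this step]
  obtain f where f: "\<And>n. length (f n) = n" "\<And>n. Q (f n)" "\<And>n. \<exists>b. f (Suc n) = f n @ [b]" by blast
  define x where "x n = last (f (Suc n))" for n
  have "f n = map x [0..<n]" for n
  proof (induction n)
    case (Suc n)
    then show ?case using f(3)[of n] by (auto simp: x_def)
  qed (use f(1)[of 0] in simp)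
  moreover have "P (f n)" for n
  proof -
    obtain u :: word where "length u = n" "take n u = f n" "\<forall>i\<le>n. P (take i u)"
      using f(2)[of n] f(1)[of n] unfolding Q_def by auto
    then show ?thesis by auto
  qed
  ultimately show ?thesis using that[of x] by simp
qed

section \<open>Extremal words; continuity and range of the 1-ratio function\<close>

context sturmian_pair
begin

lemma r_range: "0 \<le> \<alpha> \<Longrightarrow> 0 \<le> r \<alpha> \<and> r \<alpha> \<le> 1"
  using sturmian unfolding sturmian_hypothesis_def by auto

lemma sturmian_extremal:
  "0 \<le> \<alpha> \<Longrightarrow> x \<in> sturmian_set (r \<alpha>) \<Longrightarrow> (\<lambda>n. root n (mat_sum (W \<alpha> (map x [0..<n])))) \<longlonglongrightarrow> jsr \<alpha>"
  using sturmian weakly_extremal_iff unfolding sturmian_hypothesis_def by blast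

lemma floor_word_extremal:
  "0 \<le> \<alpha> \<Longrightarrow> (\<lambda>n. root n (mat_sum (W \<alpha> (map (floor_word (r \<alpha>)) [0..<n])))) \<longlonglongrightarrow> jsr \<alpha>"
  by (intro sturmian_extremal floor_word_sturmian) (auto simp: r_range)

lemma extremal_frequency:
  assumes "0 \<le> \<alpha>" "(\<lambda>n. root n (mat_sum (W \<alpha> (map x [0..<n])))) \<longlonglongrightarrow> jsr \<alpha>"
  shows "(\<lambda>n. real (count_list (map x [0..<n]) True) / real n) \<longlonglongrightarrow> r \<alpha>"
  unfolding count_list_map_upt
  using sturmian weakly_extremal_iff[OF assms(1), of x] assms unfolding sturmian_hypothesis_def by blast

lemma mat_sum_rescale:
  assumes "0 < \<alpha>"
  shows "mat_sum (W \<beta> u) = (\<beta> / \<alpha>) ^ count_list u True * mat_sum (W \<alpha> u)"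
  using assms by (subst (1 2) word_matrix_scale) (simp add: mat_sum_scaleR power_divide)

text \<open>In other words, \<open>r (exp t)\<close> is a subgradient at \<open>t\<close> of the convex function \<open>ln (jsr (exp t))\<close>.\<close>

lemma jsr_compare:
  assumes "0 < \<alpha>" "0 < \<beta>"
  shows "(\<beta> / \<alpha>) powr r \<alpha> * jsr \<alpha> \<le> jsr \<beta>"
proof -
  define u where "u n = map (floor_word (r \<alpha>)) [0..<n]" for n
  have lim: "(\<lambda>n. root n (mat_sum (W \<alpha> (u n)))) \<longlonglongrightarrow> jsr \<alpha>"
    unfolding u_def using assms by (intro floor_word_extremal) simp
  then have freq: "(\<lambda>n. real (count_list (u n) True) / real n) \<longlonglongrightarrow> r \<alpha>"
    unfolding u_def using assms by (intro extremal_frequency) simp_all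
  have "(\<lambda>n. (\<beta> / \<alpha>) powr (real (count_list (u n) True) / real n) * root n (mat_sum (W \<alpha> (u n))))
      \<longlonglongrightarrow> (\<beta> / \<alpha>) powr r \<alpha> * jsr \<alpha>"
    using assms by (intro tendsto_mult tendsto_powr tendsto_const lim freq) simp
  moreover have "(\<lambda>n. root n (max_sum \<beta> n)) \<longlonglongrightarrow> jsr \<beta>" using assms by (intro jsr_limit) simp
  ultimately show ?thesis
  proof (rule LIMSEQ_le, intro exI allI impI)
    fix n :: nat assume "1 \<le> n"
    let ?c = "count_list (u n) True"
    have "root n ((\<beta> / \<alpha>) ^ ?c) = (\<beta> / \<alpha>) powr (real ?c / real n)"
      using \<open>1 \<le> n\<close> assms by (simp add: root_powr_inverse powr_powr flip: powr_realpow)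
    then have "(\<beta> / \<alpha>) powr (real ?c / real n) * root n (mat_sum (W \<alpha> (u n))) = root n (mat_sum (W \<beta> (u n)))"
      using mat_sum_rescale[OF assms(1), of \<beta> "u n"] by (simp add: real_root_mult)
    also have "\<dots> \<le> root n (max_sum \<beta> n)"
      using mat_sum_le_max[of \<beta> "u n"] \<open>1 \<le> n\<close> by (simp add: u_def)
    finally show "(\<beta> / \<alpha>) powr (real ?c / real n) * root n (mat_sum (W \<alpha> (u n))) \<le> root n (max_sum \<beta> n)" .
  qed
qed

text \<open>If every window of length \<open>n\<close> in the Sturmian word stayed below
  \<open>jsr \<alpha> ^ n\<close>, cutting the word into such windows would give it too small a
  growth rate. A prefix is not guaranteed to reach the bound with constant 1; some window
  is.\<close>

lemma extremal_balanced_word: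
  assumes "0 \<le> \<alpha>"
  obtains u where "length u = n" "jsr \<alpha> ^ n \<le> mat_sum (W \<alpha> u)"
    "\<And>i. i \<le> n \<Longrightarrow> \<bar>real (count_list (take i u) True) - real i * r \<alpha>\<bar> \<le> 1"
proof (cases "n = 0")
  case True
  show ?thesis by (rule that[of "[]"]) (auto simp: True word_matrix_Nil mat_sum_def mat_def)
next
  case False
  define x where "x = floor_word (r \<alpha>)"
  define u where "u j = map x [j..<j + n]" for j
  have "\<exists>j. jsr \<alpha> ^ n \<le> mat_sum (W \<alpha> (u j))"
  proof (rule ccontr)
    assume neg: "\<not> ?thesis"
    \<comment> \<open>Only finitely many values lie here, so their maximum stays strictly below the
      threshold, uniformly in the position \<open>j\<close>.\<close>
    define S where "S = (\<lambda>v. mat_sum (W \<alpha> v)) ` {v. length v = n \<and> mat_sum (W \<alpha> v) < jsr \<alpha> ^ n}"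
    define \<mu> where "\<mu> = Max S"
    have fin: "finite S" unfolding S_def by (intro finite_imageI finite_subset[OF _ finite_words[of n]]) auto
    have S: "mat_sum (W \<alpha> (u j)) \<in> S" for j
      using neg by (auto simp: S_def u_def not_le)
    then have le: "mat_sum (W \<alpha> (u j)) \<le> \<mu>" for j unfolding \<mu>_def using fin by simp
    have "\<mu> \<in> S" unfolding \<mu>_def using fin S by (intro Max_in) auto
    then have "\<mu> < jsr \<alpha> ^ n" by (auto simp: S_def)
    have mu0: "0 \<le> \<mu>" using le[of 0] mat_sum_nonneg[OF nonneg_W[OF assms], of "u 0"] by linarith
    have pow: "mat_sum (W \<alpha> (map x [0..<n * Suc k])) \<le> \<mu> ^ Suc k" for k
    proof (induction k)
      case 0
      show ?case using le[of 0] by (simp add: u_def)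
    next
      case (Suc k)
      have "map x [0..<n * Suc (Suc k)] = map x [0..<n * Suc k + n]" by (simp add: algebra_simps)
      also have "\<dots> = map x [0..<n * Suc k] @ u (n * Suc k)"
        unfolding u_def by (subst upt_add_eq_append) simp_all
      finally have "W \<alpha> (map x [0..<n * Suc (Suc k)]) = W \<alpha> (u (n * Suc k)) ** W \<alpha> (map x [0..<n * Suc k])"
        by (simp only: word_matrix_append)
      then have "mat_sum (W \<alpha> (map x [0..<n * Suc (Suc k)])) \<le> mat_sum (W \<alpha> (u (n * Suc k))) * mat_sum (W \<alpha> (map x [0..<n * Suc k]))"
        using mat_sum_mult_le[OF nonneg_W[OF assms] nonneg_W[OF assms]] by metis
      also have "\<dots> \<le> \<mu> * \<mu> ^ Suc k"
        using le Suc mu0 by (intro mult_mono mat_sum_nonneg nonneg_W assms)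
      finally show ?case by simp
    qed
    have "(\<lambda>k. root (n * Suc k) (mat_sum (W \<alpha> (map x [0..<n * Suc k])))) \<longlonglongrightarrow> jsr \<alpha>"
      using LIMSEQ_subseq_LIMSEQ[OF floor_word_extremal[OF assms], of "\<lambda>k. n * Suc k"] False
      by (simp add: o_def strict_mono_def x_def)
    then have "(\<lambda>k. root (n * Suc k) (mat_sum (W \<alpha> (map x [0..<n * Suc k]))) ^ n) \<longlonglongrightarrow> jsr \<alpha> ^ n"
      by (rule tendsto_power)
    moreover have "root (n * Suc k) (mat_sum (W \<alpha> (map x [0..<n * Suc k]))) ^ n \<le> \<mu>" for k
    proof -
      let ?m = "mat_sum (W \<alpha> (map x [0..<n * Suc k]))"
      have "root (n * Suc k) ?m ^ n = root (Suc k) ?m"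
        unfolding real_root_mult_exp using False mat_sum_nonneg[OF nonneg_W[OF assms], of "map x [0..<n * Suc k]"]
        by (simp add: real_root_ge_zero del: mult_Suc_right)
      also have "\<dots> \<le> root (Suc k) (\<mu> ^ Suc k)" using pow by (intro real_root_le_mono) auto
      also have "\<dots> = \<mu>" using mu0 by (simp add: real_root_power_cancel del: power_Suc)
      finally show ?thesis .
    qed
    ultimately have "jsr \<alpha> ^ n \<le> \<mu>" by (intro LIMSEQ_le_const2) auto
    then show False using \<open>\<mu> < jsr \<alpha> ^ n\<close> by simp
  qed
  then obtain j where j: "jsr \<alpha> ^ n \<le> mat_sum (W \<alpha> (u j))" by blast
  show ?thesis
  proof (rule that[OF _ j])
    fix i assume "i \<le> n"
    then have "take i (u j) = map x [j..<j + i]" by (simp add: u_def take_map)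
    then show "\<bar>real (count_list (take i (u j)) True) - real i * r \<alpha>\<bar> \<le> 1"
      using count_list_floor_word[of "r \<alpha>" j i] r_range[OF assms] by (simp add: x_def)
  qed (simp add: u_def)
qed

text \<open>For a fixed length there are finitely many words, so a single one serves infinitely many
  \<open>k\<close>, and both of its properties are closed conditions.\<close>

lemma extremal_word_limit:
  assumes X: "\<And>k. 0 < X k" "X \<longlonglongrightarrow> \<alpha>" and \<alpha>: "0 < \<alpha>" and g: "(\<lambda>k. r (X k)) \<longlonglongrightarrow> g"
  obtains u where "length u = n" "jsr \<alpha> ^ n \<le> mat_sum (W \<alpha> u)"
    "\<And>i. i \<le> n \<Longrightarrow> \<bar>real (count_list (take i u) True) - real i * g\<bar> \<le> 1"
proof -
  have "\<forall>k. \<exists>u. length u = n \<and> jsr (X k) ^ n \<le> mat_sum (W (X k) u) \<and>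
     (\<forall>i\<le>n. \<bar>real (count_list (take i u) True) - real i * r (X k)\<bar> \<le> 1)"
    using extremal_balanced_word X(1) by (metis less_imp_le)
  then obtain U where U: "\<And>k. length (U k) = n" "\<And>k. jsr (X k) ^ n \<le> mat_sum (W (X k) (U k))"
     "\<And>k i. i \<le> n \<Longrightarrow> \<bar>real (count_list (take i (U k)) True) - real i * r (X k)\<bar> \<le> 1" by metis
  have "finite (range U)" by (rule finite_subset[OF _ finite_words[of n]]) (use U(1) in auto)
  then obtain k0 where "infinite {k. U k = U k0}"
    using pigeonhole_infinite[of "UNIV :: nat set" U] by auto
  then obtain \<phi> :: "nat \<Rightarrow> nat" where \<phi>: "strict_mono \<phi>" "\<And>k. U (\<phi> k) = U k0"
    using infinite_enumerate by blast
  define u where "u = U k0"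
  define Y where "Y k = X (\<phi> k)" for k
  have Y: "Y \<longlonglongrightarrow> \<alpha>" "(\<lambda>k. r (Y k)) \<longlonglongrightarrow> g" "\<And>k. 0 < Y k"
    using LIMSEQ_subseq_LIMSEQ[OF X(2) \<phi>(1)] LIMSEQ_subseq_LIMSEQ[OF g \<phi>(1)] X(1)
    by (simp_all add: Y_def[abs_def] o_def)
  show ?thesis
  proof (rule that[of u])
    show "length u = n" using U(1) by (simp add: u_def)
    fix i assume i: "i \<le> n"
    have "(\<lambda>k. \<bar>real (count_list (take i u) True) - real i * r (Y k)\<bar>) \<longlonglongrightarrow> \<bar>real (count_list (take i u) True) - real i * g\<bar>"
      by (intro tendsto_intros Y)
    then show "\<bar>real (count_list (take i u) True) - real i * g\<bar> \<le> 1"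
      using U(3)[OF i] \<phi>(2) by (intro LIMSEQ_le_const2) (auto simp: Y_def u_def, metis)
  next
    let ?c = "count_list u True"
    \<comment> \<open>Lower semicontinuity of \<open>jsr\<close> is enough, and
      \<open>jsr_compare\<close> gives it: these terms bound \<open>jsr (Y k) ^ n\<close> from below
      and tend to \<open>jsr \<alpha> ^ n\<close>.\<close>
    have "(\<lambda>k. ((Y k / \<alpha>) powr r \<alpha> * jsr \<alpha>) ^ n) \<longlonglongrightarrow> ((\<alpha> / \<alpha>) powr r \<alpha> * jsr \<alpha>) ^ n"
      using \<alpha> by (intro tendsto_intros Y) auto
    moreover have "(\<lambda>k. (Y k / \<alpha>) ^ ?c * mat_sum (W \<alpha> u)) \<longlonglongrightarrow> (\<alpha> / \<alpha>) ^ ?c * mat_sum (W \<alpha> u)"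
      using \<alpha> by (intro tendsto_intros Y) auto
    ultimately have "((\<alpha> / \<alpha>) powr r \<alpha> * jsr \<alpha>) ^ n \<le> (\<alpha> / \<alpha>) ^ ?c * mat_sum (W \<alpha> u)"
    proof (rule LIMSEQ_le, intro exI allI impI)
      fix k
      have "((Y k / \<alpha>) powr r \<alpha> * jsr \<alpha>) ^ n \<le> jsr (Y k) ^ n"
        using jsr_compare[OF \<alpha> Y(3)[of k]] jsr_pos[of \<alpha>] \<alpha> by (intro power_mono) auto
      also have "\<dots> \<le> mat_sum (W (Y k) u)" using U(2)[of "\<phi> k"] \<phi>(2) by (simp add: Y_def u_def)
      also have "\<dots> = (Y k / \<alpha>) ^ ?c * mat_sum (W \<alpha> u)" by (rule mat_sum_rescale[OF \<alpha>])
      finally show "((Y k / \<alpha>) powr r \<alpha> * jsr \<alpha>) ^ n \<le> (Y k / \<alpha>) ^ ?c * mat_sum (W \<alpha> u)" .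
    qed
    then show "jsr \<alpha> ^ n \<le> mat_sum (W \<alpha> u)" using \<alpha> by simp
  qed
qed

text \<open>The words found for each length are extremal only at full length; the upper bound on
  \<open>max_sum\<close> for the remaining letters transfers this to every prefix, up to the factor
  \<open>C\<close>. Koenig's lemma then yields an infinite word that is weakly extremal for
  \<open>\<alpha>\<close> and has frequency \<open>g\<close>, and the frequency clause of the
  Sturmian hypothesis applies to it.\<close>

lemma ratio_limit:
  assumes X: "\<And>k. 0 < X k" "X \<longlonglongrightarrow> \<alpha>" and \<alpha>: "0 < \<alpha>" and g: "(\<lambda>k. r (X k)) \<longlonglongrightarrow> g"
  shows "r \<alpha> = g"
proof -
  obtain C where C: "0 < C" "\<And>n. max_sum \<alpha> n \<le> C * jsr \<alpha> ^ n" using max_sum_upper[OF \<alpha>] by blast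
  have \<alpha>0: "0 \<le> \<alpha>" using \<alpha> by simp
  note jpos = jsr_pos[OF \<alpha>0]
  define P where "P v \<longleftrightarrow> \<bar>real (count_list v True) - real (length v) * g\<bar> \<le> 1 \<and> jsr \<alpha> ^ length v \<le> C * mat_sum (W \<alpha> v)" for v
  have ex: "\<exists>u. length u = n \<and> (\<forall>i\<le>n. P (take i u))" for n
  proof -
    obtain u where u: "length u = n" "jsr \<alpha> ^ n \<le> mat_sum (W \<alpha> u)"
      "\<And>i. i \<le> n \<Longrightarrow> \<bar>real (count_list (take i u) True) - real i * g\<bar> \<le> 1"
      using extremal_word_limit[OF X \<alpha> g] by blast
    have "P (take i u)" if i: "i \<le> n" for i
    proof -
      have "W \<alpha> u = W \<alpha> (drop i u) ** W \<alpha> (take i u)" by (simp flip: word_matrix_append)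
      then have "jsr \<alpha> ^ n \<le> mat_sum (W \<alpha> (drop i u)) * mat_sum (W \<alpha> (take i u))"
        using mat_sum_mult_le[OF nonneg_W[OF \<alpha>0] nonneg_W[OF \<alpha>0], of "drop i u" "take i u"] u by simp
      also have "\<dots> \<le> (C * jsr \<alpha> ^ (n - i)) * mat_sum (W \<alpha> (take i u))"
        using mat_sum_le_max[of \<alpha> "drop i u"] C(2)[of "n - i"] u(1)
        by (intro mult_right_mono mat_sum_nonneg nonneg_W \<alpha>0) simp
      finally have "jsr \<alpha> ^ (n - i) * jsr \<alpha> ^ i \<le> jsr \<alpha> ^ (n - i) * (C * mat_sum (W \<alpha> (take i u)))"
        using i by (simp add: algebra_simps flip: power_add)
      then have "jsr \<alpha> ^ i \<le> C * mat_sum (W \<alpha> (take i u))" using jpos by simp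
      moreover have "length (take i u) = i" using i u(1) by simp
      ultimately show ?thesis using u(3)[OF i] unfolding P_def by simp
    qed
    then show ?thesis using u(1) by blast
  qed
  obtain x where x: "\<And>n. P (map x [0..<n])" using koenig_words[of P, OF ex] by blast
  have "(\<lambda>n. root n (jsr \<alpha> ^ n)) \<longlonglongrightarrow> jsr \<alpha>"
    using jpos by (intro tendsto_eventually eventually_mono[OF eventually_gt_at_top[of 0]]) (simp add: real_root_power_cancel)
  then have "(\<lambda>n. root n (mat_sum (W \<alpha> (map x [0..<n])))) \<longlonglongrightarrow> jsr \<alpha>"
  proof (rule tendsto_root_between[of _ _ C])
    fix n
    show "jsr \<alpha> ^ n / C \<le> mat_sum (W \<alpha> (map x [0..<n]))" using x[of n] C(1) by (simp add: P_def field_simps)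
    show "mat_sum (W \<alpha> (map x [0..<n])) \<le> C * jsr \<alpha> ^ n"
      using mat_sum_le_max[of \<alpha> "map x [0..<n]"] C(2)[of n] by simp
  qed (use jpos C in auto)
  then have lim: "(\<lambda>n. real (count_list (map x [0..<n]) True) / real n) \<longlonglongrightarrow> r \<alpha>"
    by (rule extremal_frequency[OF \<alpha>0])
  have "(\<lambda>n. real (count_list (map x [0..<n]) True) / real n - g) \<longlonglongrightarrow> 0"
  proof (rule Lim_null_comparison)
    show "\<forall>\<^sub>F n in sequentially. norm (real (count_list (map x [0..<n]) True) / real n - g) \<le> 1 / real n"
      using eventually_gt_at_top[of 0]
    proof eventually_elim
      case (elim n)
      have "real (count_list (map x [0..<n]) True) / real n - g = (real (count_list (map x [0..<n]) True) - real n * g) / real n"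
        using elim by (simp add: field_simps)
      then show ?case using x[of n] elim by (simp add: P_def divide_right_mono)
    qed
    show "(\<lambda>n. 1 / real n) \<longlonglongrightarrow> 0" by (rule lim_1_over_n)
  qed
  then have "(\<lambda>n. real (count_list (map x [0..<n]) True) / real n) \<longlonglongrightarrow> g" by (simp add: LIM_zero_iff)
  then show ?thesis using lim LIMSEQ_unique by blast
qed

text \<open>A map into a compact interval whose graph is closed is continuous.\<close>

lemma continuous_ratio: "continuous_on {0<..} r"
proof (rule continuous_on_sequentiallyI)
  fix X :: "nat \<Rightarrow> real" and a :: real
  assume X: "\<forall>n. X n \<in> {0<..}" "a \<in> {0<..}" "X \<longlonglongrightarrow> a"
  have bdd: "range (\<lambda>k. r (X k)) \<subseteq> {0..1}" using r_range X(1) by (auto simp: less_imp_le)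
  show "(\<lambda>n. r (X n)) \<longlonglongrightarrow> r a"
  proof (rule ccontr)
    assume "\<not> ?thesis"
    then obtain e where e: "e > 0" "\<not> (\<forall>\<^sub>F n in sequentially. dist (r (X n)) (r a) < e)"
      by (auto simp: tendsto_iff)
    then have "infinite {n. \<not> dist (r (X n)) (r a) < e}"
      by (simp add: not_eventually frequently_cofinite flip: cofinite_eq_sequentially)
    then obtain \<phi> :: "nat \<Rightarrow> nat" where \<phi>: "strict_mono \<phi>" "\<And>k. e \<le> dist (r (X (\<phi> k))) (r a)"
      using infinite_enumerate by (metis (no_types, lifting) mem_Collect_eq not_less)
    have "compact {0..1::real}" by simp
    then obtain g \<psi> where \<psi>: "strict_mono \<psi>" "((\<lambda>k. r (X (\<phi> k))) \<circ> \<psi>) \<longlonglongrightarrow> g"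
      using bdd unfolding compact_def by (metis (no_types, lifting) image_subset_iff UNIV_I)
    have "r a = g"
    proof (rule ratio_limit)
      show "0 < X (\<phi> (\<psi> k))" for k using X by auto
      show "(\<lambda>k. X (\<phi> (\<psi> k))) \<longlonglongrightarrow> a"
        using LIMSEQ_subseq_LIMSEQ[OF X(3) strict_mono_o[OF \<phi>(1) \<psi>(1)]] by (simp add: o_def)
    qed (use X \<psi> in \<open>auto simp: o_def\<close>)
    then have "(\<lambda>k. dist (r (X (\<phi> (\<psi> k)))) (r a)) \<longlonglongrightarrow> 0"
      using \<psi>(2) by (simp add: o_def tendsto_dist_iff[symmetric])
    then have "e \<le> 0" using \<phi>(2) by (intro LIMSEQ_le_const) auto
    then show False using e(1) by simp
  qed
qed

text \<open>Comparison with the weight 1 reads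
  \<open>(1 / \<alpha>) powr r \<alpha> * jsr \<alpha> \<le> jsr 1\<close>. Since \<open>jsr\<close>
  stays away from 0, \<open>r \<alpha>\<close> cannot be large for small \<open>\<alpha>\<close>;
  since \<open>jsr\<close> grows at least linearly, it cannot be small for large
  \<open>\<alpha>\<close>.\<close>

lemma ratio_surj:
  assumes "0 < \<gamma>" "\<gamma> < 1"
  obtains \<alpha> where "0 < \<alpha>" "r \<alpha> = \<gamma>"
proof -
  obtain c0 c1 where c: "0 < c0" "0 < c1" "\<And>\<alpha>. 0 \<le> \<alpha> \<Longrightarrow> c0 \<le> jsr \<alpha>" "\<And>\<alpha>. 0 \<le> \<alpha> \<Longrightarrow> \<alpha> * c1 \<le> jsr \<alpha>"
    using jsr_lower by metis
  \<comment> \<open>\<open>K\<close> exceeds \<open>jsr 1 / c0\<close> and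
    \<open>jsr 1 / c1\<close>; the end points \<open>1 / t\<close> and \<open>b\<close> of the
    interval are chosen so that \<open>t powr \<gamma>\<close> and
    \<open>b powr (1 - \<gamma>)\<close> equal \<open>K\<close>.\<close>
  define K where "K = max 1 (max (jsr 1 / c0) (jsr 1 / c1)) + 1"
  have "1 < K" "jsr 1 / c0 < K" "jsr 1 / c1 < K" unfolding K_def by linarith+
  then have K: "1 < K" "jsr 1 < K * c0" "jsr 1 < K * c1"
    using c by (simp_all add: divide_less_eq)
  have cmp: "(1 / \<alpha>) powr r \<alpha> * jsr \<alpha> \<le> jsr 1" if "0 < \<alpha>" for \<alpha> using jsr_compare[OF that, of 1] by simp
  define t where "t = K powr (1 / \<gamma>)"
  have t: "1 < t" "t powr \<gamma> = K" using K assms by (auto simp: t_def powr_powr)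
  have small: "r (1 / t) \<le> \<gamma>"
  proof (rule ccontr)
    assume "\<not> ?thesis"
    then have "K \<le> t powr r (1 / t)" using t by (metis less_imp_le not_le powr_mono)
    then have "K * c0 \<le> t powr r (1 / t) * jsr (1 / t)"
      using c t K by (intro mult_mono) auto
    then show False using cmp[of "1 / t"] t K by simp
  qed
  define b where "b = K powr (1 / (1 - \<gamma>))"
  have b: "1 < b" "b powr (1 - \<gamma>) = K" using K assms by (auto simp: b_def powr_powr)
  have large: "\<gamma> \<le> r b"
  proof (rule ccontr)
    assume "\<not> ?thesis"
    then have "b powr (- \<gamma>) \<le> b powr (- r b)" using b by (intro powr_mono) auto
    then have "b powr (- \<gamma>) * (b * c1) \<le> b powr (- r b) * jsr b"
      using c b by (intro mult_mono) auto
    also have "b powr (- r b) = (1 / b) powr r b" using b by (simp add: powr_minus_divide powr_divide)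
    also have "\<dots> * jsr b \<le> jsr 1" using cmp b by simp
    also have "b powr (- \<gamma>) * (b * c1) = K * c1"
    proof -
      have "b powr (- \<gamma>) * b = b powr (1 - \<gamma>)" using powr_add[of b "- \<gamma>" 1] b by simp
      then show ?thesis using b by (simp flip: mult.assoc)
    qed
    finally show False using K by simp
  qed
  have "1 / t \<le> b" using t b by (smt (verit) divide_le_eq_1)
  moreover have "continuous_on {1 / t..b} r"
    by (rule continuous_on_subset[OF continuous_ratio]) (use t in \<open>auto intro: less_le_trans[of _ "1 / t"]\<close>)
  ultimately obtain \<alpha> where "1 / t \<le> \<alpha>" "r \<alpha> = \<gamma>" using IVT'[of r "1 / t" \<gamma> b] small large by blast
  moreover have "0 < 1 / t" using t by simp
  ultimately have "0 < \<alpha>" by linarith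
  then show ?thesis using \<open>r \<alpha> = \<gamma>\<close> that by blast
qed

text \<open>Uniqueness is claimed on the closed half-line, and the argument with
  \<open>ln \<alpha>\<close> does not cover the weight 0. There a positive frequency would force the
  letter 1, hence a zero factor, into every long product, contradicting
  \<open>jsr 0 > 0\<close>.\<close>

lemma ratio_0: "r 0 = 0"
proof (rule ccontr)
  assume "r 0 \<noteq> 0"
  then have pos: "0 < r 0" using r_range[of 0] by simp
  define N where "N = nat \<lceil>2 / r 0\<rceil>"
  have "\<forall>\<^sub>F n in sequentially. root n (mat_sum (W 0 (map (floor_word (r 0)) [0..<n]))) = 0"
    using eventually_ge_at_top[of N]
  proof eventually_elim
    case (elim n)
    have "2 / r 0 \<le> real n" using elim unfolding N_def by linarith
    then have "2 \<le> real n * r 0" using pos by (simp add: field_simps)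
    then have "count_list (map (floor_word (r 0)) [0..<n]) True \<noteq> 0"
      using count_list_floor_word[of "r 0" 0 n] r_range[of 0] by auto
    then have "W 0 (map (floor_word (r 0)) [0..<n]) = 0"
      by (subst word_matrix_scale) simp
    then show ?case by (simp add: mat_sum_def)
  qed
  then have "(\<lambda>n. root n (mat_sum (W 0 (map (floor_word (r 0)) [0..<n])))) \<longlonglongrightarrow> 0"
    by (rule tendsto_eventually)
  then have "jsr 0 = 0" using floor_word_extremal[of 0] LIMSEQ_unique by blast
  then show False using jsr_pos[of 0] by simp
qed

end

section \<open>Spectral radii along the standard words\<close>

text \<open>Two consecutive increments eventually have opposite signs if \<open>x\<close> is
  nonzero, and the doubling of \<open>q\<close> over two steps makes the first of them dominate.
  Then \<open>y\<close> would strictly increase towards 0 along the indices of one parity, so it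
  would be negative there.\<close>

lemma alternating_increments_limit:
  fixes y F q :: "nat \<Rightarrow> real"
  assumes y: "y \<longlonglongrightarrow> 0" "\<forall>\<^sub>F n in sequentially. 0 \<le> y n"
    and step: "\<And>n. y n - y (Suc n) = (- 1) ^ n * F n / (q n * q (Suc n))"
    and q: "\<And>n. 0 < q n" "\<And>n. 2 * q n \<le> q (n + 2)"
    and F: "F \<longlonglongrightarrow> x"
  shows "x = 0"
proof (rule ccontr)
  assume x: "x \<noteq> 0"
  have "\<forall>\<^sub>F n in sequentially. dist (F n) x < \<bar>x\<bar> / 4" using x by (intro tendstoD[OF F]) simp
  with y(2) have "\<forall>\<^sub>F n in sequentially. 0 \<le> y n \<and> dist (F n) x < \<bar>x\<bar> / 4" by eventually_elim simp
  then obtain N where N: "\<And>n. n \<ge> N \<Longrightarrow> 0 \<le> y n \<and> \<bar>F n - x\<bar> < \<bar>x\<bar> / 4"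
    unfolding eventually_sequentially dist_real_def by blast
  obtain m where m: "m \<ge> N" "(- 1) ^ m * x = - \<bar>x\<bar>"
  proof (cases "(- 1) ^ N * x = - \<bar>x\<bar>")
    case False
    then have "(- 1) ^ Suc N * x = - \<bar>x\<bar>" by (cases "even N") (auto simp: abs_if split: if_splits)
    then show ?thesis using that[of "Suc N"] by simp
  qed (use that[of N] in simp)
  \<comment> \<open>The tolerance \<open>|x| / 4\<close> leaves the factors 3/4 and 5/4 of
    \<open>|x|\<close>; the doubling halves the second, and a margin of 3/4 - 5/8 = 1/8
    remains.\<close>
  have inc: "y n < y (n + 2)" if n: "n \<ge> N" "(- 1) ^ n * x = - \<bar>x\<bar>" for n
  proof -
    let ?q0 = "q n" and ?q1 = "q (Suc n)" and ?q2 = "q (n + 2)"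
    have qp: "0 < ?q0" "0 < ?q1" "0 < ?q2" using q(1) by auto
    have sgn: "\<bar>(- 1) ^ n * z\<bar> = \<bar>z\<bar>" for z :: real by (simp add: abs_mult)
    have "\<bar>(- 1) ^ n * (F n - x)\<bar> < \<bar>x\<bar> / 4" unfolding sgn using N[OF n(1)] by simp
    then have F0: "(- 1) ^ n * F n \<le> - (3 / 4) * \<bar>x\<bar>" using n(2) unfolding right_diff_distrib by linarith
    have "\<bar>(- 1) ^ n * (F (Suc n) - x)\<bar> < \<bar>x\<bar> / 4" unfolding sgn using N[of "Suc n"] n(1) by simp
    then have F1: "- ((- 1) ^ n * F (Suc n)) \<le> 5 / 4 * \<bar>x\<bar>" using n(2) unfolding right_diff_distrib by linarith
    have "y n - y (n + 2) = (y n - y (Suc n)) + (y (Suc n) - y (Suc (Suc n)))" by simp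
    also have "\<dots> = (- 1) ^ n * F n / (?q0 * ?q1) + - ((- 1) ^ n * F (Suc n)) / (?q1 * ?q2)"
      unfolding step by simp
    also have "\<dots> \<le> - (3 / 4) * \<bar>x\<bar> / (?q0 * ?q1) + 5 / 4 * \<bar>x\<bar> / (?q1 * ?q2)"
      using F0 F1 qp by (intro add_mono divide_right_mono) auto
    also have "5 / 4 * \<bar>x\<bar> / (?q1 * ?q2) \<le> 5 / 4 * \<bar>x\<bar> / (?q1 * (2 * ?q0))"
      using qp q(2)[of n] by (intro divide_left_mono mult_left_mono) auto
    also have "- (3 / 4) * \<bar>x\<bar> / (?q0 * ?q1) + 5 / 4 * \<bar>x\<bar> / (?q1 * (2 * ?q0)) = - (1 / 8) * \<bar>x\<bar> / (?q0 * ?q1)"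
      using qp by (simp add: field_simps)
    also have "\<dots> < 0" using x qp by (simp add: divide_less_0_iff)
    finally show ?thesis by simp
  qed
  define z where "z k = y (m + 2 * k)" for k
  have "z k < z (Suc k)" for k
    using inc[of "m + 2 * k"] m by (simp add: z_def power_add power_mult)
  note z = this
  then have "incseq z" by (intro incseq_SucI less_imp_le)
  moreover have "z \<longlonglongrightarrow> 0"
    unfolding z_def by (intro LIMSEQ_subseq_LIMSEQ[OF y(1), of "\<lambda>k. m + 2 * k", unfolded o_def]) (simp add: strict_mono_def)
  ultimately have "z 1 \<le> 0" by (rule incseq_le)
  then show False using z[of 0] N[OF m(1)] by (simp add: z_def)
qed

declare cf_num.simps(3) [simp del] cf_den.simps(3) [simp del] std_word.simps(3) [simp del]

locale sturmian_irrational = sturmian_pair A0 A1 r + continued_fraction \<gamma> a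
  for A0 A1 :: "real^2^2" and r :: "real \<Rightarrow> real" and \<gamma> :: real and a :: "nat \<Rightarrow> nat"
begin

abbreviation M :: "nat \<Rightarrow> real^2^2" where "M n \<equiv> W 1 (w n)"
abbreviation rho :: "nat \<Rightarrow> real" where "rho n \<equiv> spectral_radius (M n)"
abbreviation lrho :: "nat \<Rightarrow> real" where "lrho n \<equiv> ln (rho n)"

lemma pos_M: "n \<ge> 2 \<Longrightarrow> pos_mat (M n)"
  by (intro pos_W std_word_letters)

text \<open>Logarithms are taken from index 0 on, where the matrices need not be positive; there the
  positive traces of \<open>A0\<close> and \<open>A1\<close> step in.\<close>

lemma rho_pos: "0 < rho n"
proof (rule spectral_radius_pos)
  show "0 \<le> M n $ i $ j" for i j using nonneg_W[of 1 "w n"] by (simp add: nonneg_mat_def)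
  have W1: "W 1 [False] = A0" "W 1 [True] = A1" by (simp_all add: word_matrix_Cons word_matrix_Nil letter_matrix_def)
  have pos: "0 < trace B" if "pos_mat B" for B
    using that by (simp add: trace_def sum_2 pos_mat_def add_pos_pos)
  consider "n = 0" | "n = 1" "a 1 = 1" | "n = 1" "a 1 \<ge> 2" | "n \<ge> 2" using a_pos[of 1] by linarith
  then show "0 < trace (M n)"
  proof cases
    case 3
    then have "set (w n) = {False, True}" by (auto simp: set_word_power)
    then show ?thesis by (intro pos pos_W)
  qed (use W1 trace_A pos pos_M in auto)
qed

text \<open>Products are formed in reverse, so the suffix \<open>w n\<close> of
  \<open>w (n + 2)\<close> supplies the left factor.\<close>

lemma M_step: "M (n + 2) = M n ** W 1 (word_power (w (n + 1)) (a (n + 2)))"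
  by (simp add: word_matrix_append numeral_2_eq_2 std_word.simps(3))

section \<open>Perron vectors along the standard words\<close>

lemma perron_vectors:
  obtains lv rv where "\<And>n. n \<ge> 2 \<Longrightarrow> pos_vec (lv n)" "\<And>n. n \<ge> 2 \<Longrightarrow> pos_vec (rv n)"
    "\<And>n. n \<ge> 2 \<Longrightarrow> lv n v* M n = rho n *s lv n" "\<And>n. n \<ge> 2 \<Longrightarrow> M n *v rv n = rho n *s rv n"
proof -
  have "\<forall>n. \<exists>v u. n \<ge> 2 \<longrightarrow> pos_vec v \<and> pos_vec u \<and> v v* M n = rho n *s v \<and> M n *v u = rho n *s u"
    using perron_2x2[OF pos_M] by metis
  then show ?thesis using that by metis
qed

lemma pos_vec_row_power:
  "pos_mat (W 1 u) \<Longrightarrow> pos_vec v \<Longrightarrow> pos_vec (v v* W 1 (word_power u k))"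
proof (induction k arbitrary: v)
  case (Suc k)
  then show ?case by (simp add: word_matrix_append pos_vec_row flip: vector_matrix_mul_assoc)
qed (simp add: word_matrix_Nil)

lemma contracts_word_power:
  assumes "pos_mat (W 1 u)" "contracts (W 1 u) c" "0 \<le> c"
  shows "contracts (W 1 (word_power u k)) (c ^ k)"
proof (induction k)
  case (Suc k)
  then have "contracts (W 1 (word_power u k) ** W 1 u) (c ^ k * c)"
    using assms by (intro contracts_mult pos_vec_row_power)
  then show ?case by (simp add: word_matrix_append mult.commute)
qed (simp add: word_matrix_Nil contracts_id)

lemma left_eigenvector_power:
  assumes "v v* W 1 u = l *s v"
  shows "v v* W 1 (word_power u k) = l ^ k *s v"
proof (induction k)
  case (Suc k)
  then show ?case using assms
    by (simp add: word_matrix_append vector_smult_assoc mult.commute scalar_vector_matrix_assoc flip: vector_matrix_mul_assoc)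
qed (simp add: word_matrix_Nil)

text \<open>Contraction constants multiply along a product while lengths add, so a bound of the form
  \<open>\<theta> ^ length\<close> for \<open>M 2\<close> and \<open>M 3\<close> passes to all later
  matrices.\<close>

lemma contraction_rate:
  obtains \<theta> where "0 < \<theta>" "\<theta> < 1" "\<And>n. n \<ge> 2 \<Longrightarrow> contracts (M n) (\<theta> ^ den n)"
proof -
  obtain k2 where k2: "0 \<le> k2" "k2 < 1" "contracts (M 2) k2" using contracts_pos_mat[OF pos_M[of 2]] by auto
  obtain k3 where k3: "0 \<le> k3" "k3 < 1" "contracts (M 3) k3" using contracts_pos_mat[OF pos_M[of 3]] by auto
  \<comment> \<open>Taking the root of order \<open>Q\<close> of a common bound \<open>k\<close> for
    both initial constants makes \<open>\<theta> ^ den 2\<close> and \<open>\<theta> ^ den 3\<close>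
    at least \<open>k\<close>.\<close>
  define Q where "Q = max (den 2) (den 3)"
  have Q: "0 < Q" using den_pos[of 2] by (simp add: Q_def)
  define k where "k = (max k2 k3 + 1) / 2"
  have k: "0 < k" "k < 1" "k2 \<le> k" "k3 \<le> k" using k2 k3 by (auto simp: k_def max_def)
  define \<theta> where "\<theta> = root Q k"
  have th: "0 < \<theta>" "\<theta> < 1" "\<theta> ^ Q = k" using k Q by (auto simp: \<theta>_def)
  have pw: "k \<le> \<theta> ^ j" if "j \<le> Q" for j using power_decreasing[OF that, of \<theta>] th by simp
  have "contracts (M (n + 2)) (\<theta> ^ den (n + 2))" for n
  proof (induction n rule: induct_nat_012)
    case 0
    have "k2 \<le> \<theta> ^ den 2" using pw[of "den 2"] k by (simp add: Q_def)
    then show ?case using contracts_mono[OF k2(3)] by (simp add: numeral_2_eq_2)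
  next
    case 1
    have "k3 \<le> \<theta> ^ den 3" using pw[of "den 3"] k by (simp add: Q_def)
    then show ?case using contracts_mono[OF k3(3)] by (simp add: numeral_3_eq_3)
  next
    case (ge2 n)
    let ?b = "a (n + 2 + 2)"
    have "contracts (M (n + 2) ** W 1 (word_power (w (n + 2 + 1)) ?b)) (\<theta> ^ den (n + 2) * (\<theta> ^ den (n + 2 + 1)) ^ ?b)"
    proof (rule contracts_mult)
      show "contracts (M (n + 2)) (\<theta> ^ den (n + 2))" using ge2(1) .
      show "contracts (W 1 (word_power (w (n + 2 + 1)) ?b)) ((\<theta> ^ den (n + 2 + 1)) ^ ?b)"
        using ge2(2) th pos_M[of "n + 2 + 1"] by (intro contracts_word_power) simp_all
      show "pos_vec (v v* M (n + 2))" if "pos_vec v" for v using that pos_M[of "n + 2"] pos_vec_row by simp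
    qed (use th in simp)
    moreover have "\<theta> ^ den (n + 2) * (\<theta> ^ den (n + 2 + 1)) ^ ?b = \<theta> ^ den (n + 2 + 2)"
      unfolding den_rec[of "n + 2"] by (simp add: mult.commute add.commute flip: power_mult power_add)
    ultimately show ?case using M_step[of "n + 2"] by (simp)
  qed
  then have "contracts (M n) (\<theta> ^ den n)" if "n \<ge> 2" for n using that by (metis add.commute le_Suc_ex)
  then show ?thesis using th that by blast
qed

lemma std_word_prefix: "n \<ge> 2 \<Longrightarrow> \<exists>z. w n = w 2 @ z"
proof (induction n rule: nat_induct_at_least)
  case base
  then show ?case by simp
next
  case (Suc n)
  then obtain m where m: "n = Suc m" by (cases n) auto
  obtain b where b: "a (Suc (Suc m)) = Suc b" using a_pos[of "Suc (Suc m)"] gr0_implies_Suc by auto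
  then have "w (Suc n) = w n @ (word_power (w n) b @ w m)" unfolding m by (simp add: std_word.simps(3))
  then show ?case using Suc.IH by (metis append.assoc)
qed

text \<open>All these words begin with \<open>w 2\<close>, so \<open>M 2\<close> is the right-hand
  factor of every \<open>M n\<close>, and each row image lies in the image of the quadrant under
  this one positive matrix.\<close>

lemma log_slope_bound:
  obtains D where "0 < D" "\<And>n v. n \<ge> 2 \<Longrightarrow> pos_vec v \<Longrightarrow> \<bar>log_slope (v v* M n)\<bar> \<le> D"
proof -
  obtain D where D: "\<And>v. (\<And>i. 0 \<le> v $ i) \<Longrightarrow> v \<noteq> 0 \<Longrightarrow> \<bar>log_slope (v v* M 2)\<bar> \<le> D"
    using log_slope_image_bounded[OF pos_M[of 2]] by auto
  have "\<bar>log_slope (v v* M n)\<bar> \<le> max 1 D" if n: "n \<ge> 2" and v: "pos_vec v" for n v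
  proof -
    obtain z where "w n = w 2 @ z" using std_word_prefix[OF n] by blast
    then have eq: "v v* M n = (v v* W 1 z) v* M 2" by (simp add: word_matrix_append vector_matrix_mul_assoc)
    have "0 \<le> (v v* W 1 z) $ i" for i
      using nonneg_W[of 1 z] v by (auto simp: vector_matrix_mult_2 nonneg_mat_def pos_vec_def less_imp_le)
    moreover have "v v* W 1 z \<noteq> 0"
    proof
      assume "v v* W 1 z = 0"
      then have "v v* M n = 0" unfolding eq by simp
      moreover have "pos_vec (v v* M n)" by (intro pos_vec_row v pos_M n)
      ultimately show False by (simp add: pos_vec_def)
    qed
    ultimately show ?thesis unfolding eq using D by (meson le_max_iff_disj)
  qed
  then show ?thesis using that[of "max 1 D"] by auto
qed

definition defect :: "nat \<Rightarrow> real" where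
  "defect n = lrho (n + 2) - real (a (n + 2)) * lrho (n + 1) - lrho n"

text \<open>With \<open>v n\<close>, \<open>u n\<close> the left and right Perron vectors of \<open>M n\<close>, one has exactly
  \<open>rho (n+2) / rho (n+1) ^ a (n+2) = (v (n+2) \<bullet> M n u (n+1)) / (v (n+2) \<bullet> u (n+1))\<close> and
  \<open>rho n = (v n \<bullet> M n u (n+1)) / (v n \<bullet> u (n+1))\<close>. So the defect is the logarithm of a cross ratio,
  and the left Perron vectors converge very fast because each \<open>w (n+1)\<close> begins with a high power
  of \<open>w n\<close>.\<close>

lemma defect_bound:
  obtains C \<zeta> where "0 \<le> C" "0 < \<zeta>" "\<zeta> < 1" "\<And>n. n \<ge> 3 \<Longrightarrow> \<bar>defect n\<bar> \<le> C * \<zeta> ^ den (n + 1)"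
proof -
  obtain lv rv where lv: "\<And>n. n \<ge> 2 \<Longrightarrow> pos_vec (lv n)" and rv: "\<And>n. n \<ge> 2 \<Longrightarrow> pos_vec (rv n)"
    and lM: "\<And>n. n \<ge> 2 \<Longrightarrow> lv n v* M n = rho n *s lv n" and rM: "\<And>n. n \<ge> 2 \<Longrightarrow> M n *v rv n = rho n *s rv n"
    using perron_vectors by blast
  obtain \<theta> where th: "0 < \<theta>" "\<theta> < 1" "\<And>n. n \<ge> 2 \<Longrightarrow> contracts (M n) (\<theta> ^ den n)" using contraction_rate by blast
  obtain D where D: "0 < D" "\<And>n v. n \<ge> 2 \<Longrightarrow> pos_vec v \<Longrightarrow> \<bar>log_slope (v v* M n)\<bar> \<le> D" using log_slope_bound by blast
  define h where "h n = log_slope (lv n)" for n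
  \<comment> \<open>The contraction exponent \<open>den (n + 1) * a (n + 2)\<close> is only known to
    be at least half of \<open>den (n + 2)\<close>; the square root pays for the factor 2.\<close>
  define \<eta> where "\<eta> = sqrt \<theta>"
  have eta: "0 < \<eta>" "\<eta> < 1" "\<eta>\<^sup>2 = \<theta>" using th by (auto simp: \<eta>_def)
  have defect_h: "\<bar>defect n\<bar> \<le> \<bar>h (n + 2) - h n\<bar>" if n: "n \<ge> 2" for n
  proof -
    let ?v2 = "lv (n + 2)" and ?v0 = "lv n" and ?u = "rv (n + 1)" and ?b = "a (n + 2)"
    define y where "y = M n *v ?u"
    have p: "pos_vec ?v2" "pos_vec ?v0" "pos_vec ?u" "pos_vec y"
      using n lv rv pos_vec_col[OF rv pos_M] by (simp_all add: y_def)
    have "M (n + 2) *v ?u = rho (n + 1) ^ ?b *s y"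
      unfolding M_step matrix_vector_mul_assoc[symmetric] y_def
      using word_power_eigenvector[OF rM[of "n + 1"], of ?b] n by (simp add: vector_scalar_commute)
    then have "rho (n + 2) * (?v2 \<bullet> ?u) = rho (n + 1) ^ ?b * (?v2 \<bullet> y)"
      using dot_lmul_matrix[of ?v2 "M (n + 2)" ?u] lM[of "n + 2"] by (simp add: inner_2 algebra_simps)
    then have "ln (rho (n + 2) * (?v2 \<bullet> ?u)) = ln (rho (n + 1) ^ ?b * (?v2 \<bullet> y))" by simp
    then have 1: "lrho (n + 2) + ln (?v2 \<bullet> ?u) = real ?b * lrho (n + 1) + ln (?v2 \<bullet> y)"
      using rho_pos pos_vec_inner[OF p(1) p(3)] pos_vec_inner[OF p(1) p(4)] by (simp add: ln_mult_pos ln_realpow)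
    have "rho n * (?v0 \<bullet> ?u) = ?v0 \<bullet> y"
      using dot_lmul_matrix[of ?v0 "M n" ?u] lM[of n] n by (simp add: inner_2 algebra_simps y_def)
    then have "ln (rho n * (?v0 \<bullet> ?u)) = ln (?v0 \<bullet> y)" by simp
    then have 2: "lrho n + ln (?v0 \<bullet> ?u) = ln (?v0 \<bullet> y)"
      using rho_pos pos_vec_inner[OF p(2) p(3)] by (simp add: ln_mult_pos)
    have "defect n = (ln (?v2 \<bullet> y) - ln (?v0 \<bullet> y)) - (ln (?v2 \<bullet> ?u) - ln (?v0 \<bullet> ?u))"
      using 1 2 unfolding defect_def by linarith
    then show ?thesis unfolding h_def using ln_inner_cross_ratio[OF p(1,2,4,3)] by simp
  qed
  have h_step: "\<bar>h (n + 2) - h (n + 1)\<bar> \<le> 2 * D * \<eta> ^ den (n + 2)" if n: "n \<ge> 2" for n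
  proof -
    let ?b = "a (n + 2)" and ?v2 = "lv (n + 2)" and ?v1 = "lv (n + 1)"
    \<comment> \<open>Up to scaling, \<open>P\<close> sends \<open>lv (n + 2) v* M n\<close> to
      \<open>lv (n + 2)\<close> and fixes \<open>lv (n + 1)\<close>, so it shrinks a distance of at
      most \<open>2 * D\<close>.\<close>
    define P where "P = W 1 (word_power (w (n + 1)) ?b)"
    have cP: "contracts P ((\<theta> ^ den (n + 1)) ^ ?b)"
      unfolding P_def using n th pos_M[of "n + 1"] by (intro contracts_word_power) auto
    define v where "v = ?v2 v* M n"
    have pv: "pos_vec v" unfolding v_def using n lv pos_M by (intro pos_vec_row) auto
    have "v v* P = rho (n + 2) *s ?v2"
      unfolding v_def P_def vector_matrix_mul_assoc M_step[symmetric] using lM[of "n + 2"] by simp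
    then have h2: "log_slope (v v* P) = h (n + 2)"
      unfolding h_def using log_slope_scale[OF lv rho_pos] by simp
    have "?v1 v* P = rho (n + 1) ^ ?b *s ?v1"
      unfolding P_def using n by (intro left_eigenvector_power lM) simp
    then have h1: "log_slope (?v1 v* P) = h (n + 1)"
      unfolding h_def using log_slope_scale[OF lv zero_less_power[OF rho_pos]] n by simp
    have "log_slope (?v1 v* M (n + 1)) = h (n + 1)"
      unfolding h_def using lM[of "n + 1"] log_slope_scale[OF lv rho_pos] n by simp
    then have "\<bar>h (n + 1)\<bar> \<le> D" using D(2)[of "n + 1" ?v1] lv[of "n + 1"] n by simp
    moreover have "\<bar>log_slope v\<bar> \<le> D" unfolding v_def using D(2)[of n ?v2] lv n by simp
    ultimately have "\<bar>log_slope v - log_slope ?v1\<bar> \<le> 2 * D" unfolding h_def by linarith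
    moreover have "\<bar>h (n + 2) - h (n + 1)\<bar> \<le> (\<theta> ^ den (n + 1)) ^ ?b * \<bar>log_slope v - log_slope ?v1\<bar>"
      using cP pv lv[of "n + 1"] n unfolding contracts_def h1[symmetric] h2[symmetric] by simp
    moreover have "0 \<le> (\<theta> ^ den (n + 1)) ^ ?b" using th by simp
    ultimately have "\<bar>h (n + 2) - h (n + 1)\<bar> \<le> (\<theta> ^ den (n + 1)) ^ ?b * (2 * D)"
      by (meson mult_left_mono order_trans)
    also have "(\<theta> ^ den (n + 1)) ^ ?b = \<eta> ^ (2 * (den (n + 1) * ?b))"
      unfolding eta(3)[symmetric] by (simp add: mult.assoc flip: power_mult)
    also have "\<dots> \<le> \<eta> ^ den (n + 2)"
    proof (rule power_decreasing)
      have "den n \<le> den (n + 1)" using den_mono by simp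
      also have "\<dots> \<le> den (n + 1) * ?b" using a_pos[of "n + 2"] by simp
      finally show "den (n + 2) \<le> 2 * (den (n + 1) * ?b)" unfolding den_rec by (simp add: mult.commute)
    qed (use eta in auto)
    finally show ?thesis using D by (simp add: mult.commute mult_right_mono)
  qed
  have "\<bar>defect n\<bar> \<le> 4 * D * \<eta> ^ den (n + 1)" if n: "n \<ge> 3" for n
  proof -
    \<comment> \<open>The difference \<open>h (n + 2) - h n\<close> is split into two steps, and the
      earlier one is \<open>h_step\<close> at \<open>n - 1\<close>; whence
      \<open>n \<ge> 3\<close>.\<close>
    obtain m where m: "n = m + 1" "m \<ge> 2" using n by (intro that[of "n - 1"]) auto
    have "\<bar>h (n + 2) - h (n + 1)\<bar> \<le> 2 * D * \<eta> ^ den (n + 2)" using h_step[of n] n by simp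
    also have "\<eta> ^ den (n + 2) \<le> \<eta> ^ den (n + 1)"
      using den_mono[of "n + 1"] eta by (intro power_decreasing) auto
    finally have "\<bar>h (n + 2) - h (n + 1)\<bar> \<le> 2 * D * \<eta> ^ den (n + 1)" using D by simp
    moreover have "\<bar>h (n + 1) - h n\<bar> \<le> 2 * D * \<eta> ^ den (n + 1)" using h_step[of m] m by simp
    ultimately show ?thesis using defect_h[of n] n by linarith
  qed
  then show ?thesis using that[of "4 * D" \<eta>] D eta by simp
qed

section \<open>Convergence of the cross terms and uniqueness of the weight\<close>

definition cross_term :: "nat \<Rightarrow> real" where
  "cross_term n = (- 1) ^ n * (real (den n) * lrho (n + 1) - real (den (n + 1)) * lrho n)"

lemma cross_term_Suc: "cross_term (Suc n) - cross_term n = (- 1) ^ Suc n * real (den (n + 1)) * defect n"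
proof -
  have "real (den (n + 2)) = real (a (n + 2)) * real (den (n + 1)) + real (den n)" unfolding den_rec by simp
  then show ?thesis unfolding cross_term_def defect_def
    by (simp add: algebra_simps)
qed

lemma convergent_cross_term: "convergent cross_term"
proof -
  obtain C \<zeta> where C: "0 \<le> C" "0 < \<zeta>" "\<zeta> < 1" "\<And>n. n \<ge> 3 \<Longrightarrow> \<bar>defect n\<bar> \<le> C * \<zeta> ^ den (n + 1)"
    using defect_bound by blast
  \<comment> \<open>With \<open>k = den (n + 1)\<close>, one factor \<open>\<eta> ^ k\<close> of the
    decay absorbs the factor \<open>k\<close> of the increment; the other is summable because
    \<open>k\<close> is at least \<open>n\<close>.\<close>
  define \<eta> where "\<eta> = sqrt \<zeta>"
  have eta: "0 < \<eta>" "\<eta> < 1" "\<eta>\<^sup>2 = \<zeta>" using C by (auto simp: \<eta>_def)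
  have "(\<lambda>k. real k * \<eta> ^ k) \<longlonglongrightarrow> 0" using eta by (intro powser_times_n_limit_0) simp
  then have "Bseq (\<lambda>k. real k * \<eta> ^ k)" by (intro convergent_imp_Bseq convergentI)
  then obtain B where B: "0 < B" "\<And>k. norm (real k * \<eta> ^ k) \<le> B" by (auto elim: BseqE)
  have "summable (\<lambda>n. cross_term (Suc n) - cross_term n)"
  proof (rule summable_comparison_test')
    show "summable (\<lambda>n. C * B * \<eta> ^ n)" using eta by (intro summable_mult summable_geometric) simp
    fix n :: nat assume n: "n \<ge> 3"
    let ?k = "den (n + 1)"
    have "norm (cross_term (Suc n) - cross_term n) = real ?k * \<bar>defect n\<bar>"
      unfolding cross_term_Suc by (simp add: abs_mult)
    also have "\<dots> \<le> real ?k * (C * \<zeta> ^ ?k)" using C(4)[OF n] by (intro mult_left_mono) auto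
    also have "\<zeta> ^ ?k = \<eta> ^ ?k * \<eta> ^ ?k" unfolding eta(3)[symmetric] by (simp add: power_mult_distrib power2_eq_square)
    also have "real ?k * (C * (\<eta> ^ ?k * \<eta> ^ ?k)) = C * (real ?k * \<eta> ^ ?k) * \<eta> ^ ?k" by simp
    also have "\<dots> \<le> C * B * \<eta> ^ n"
    proof (intro mult_mono mult_left_mono)
      show "real ?k * \<eta> ^ ?k \<le> B" using B(2)[of ?k] by simp
      show "\<eta> ^ ?k \<le> \<eta> ^ n" using den_ge[of "n + 1"] eta by (intro power_decreasing) auto
    qed (use C B eta in auto)
    finally show "norm (cross_term (Suc n) - cross_term n) \<le> C * B * \<eta> ^ n" .
  qed
  then have "convergent (\<lambda>n. \<Sum>i<n. cross_term (Suc i) - cross_term i)" by (simp add: summable_iff_convergent)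
  then show ?thesis by (simp add: sum_lessThan_telescope convergent_diff_const_right_iff)
qed

text \<open>Here \<open>la n\<close> is the logarithm of the Perron eigenvalue of the weighted
  matrix, at least from index 2 on, and \<open>y n\<close> is the gap between
  \<open>ln (jsr \<alpha>)\<close> and its normalisation. The gap is eventually non-negative, tends
  to 0, and has the increments that force the limit of \<open>F\<close> to vanish.\<close>

lemma ratio_unique:
  assumes E: "cross_term \<longlonglongrightarrow> L" and \<alpha>: "0 \<le> \<alpha>" "r \<alpha> = \<gamma>"
  shows "\<alpha> = exp (- L)"
proof -
  have pos: "0 < \<alpha>" using \<alpha> ratio_0 gamma by (cases "\<alpha> = 0") auto
  define la where "la n = lrho n + real (num n) * ln \<alpha>" for n
  define y where "y n = ln (jsr \<alpha>) - la n / real (den n)" for n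
  define F where "F n = cross_term n + ln \<alpha>" for n
  have dpos: "0 < real (den n)" for n using den_pos[of n] by simp
  have jpos: "0 < jsr \<alpha>" by (rule jsr_pos[OF \<alpha>(1)])
  obtain D where D: "0 < D" "\<And>n v. n \<ge> 2 \<Longrightarrow> pos_vec v \<Longrightarrow> \<bar>log_slope (v v* M n)\<bar> \<le> D" using log_slope_bound by blast
  obtain lv rv where lv: "\<And>n. n \<ge> 2 \<Longrightarrow> pos_vec (lv n)" and rv: "\<And>n. n \<ge> 2 \<Longrightarrow> pos_vec (rv n)"
    and lM: "\<And>n. n \<ge> 2 \<Longrightarrow> lv n v* M n = rho n *s lv n" and rM: "\<And>n. n \<ge> 2 \<Longrightarrow> M n *v rv n = rho n *s rv n"
    using perron_vectors by blast
  have Wa: "W \<alpha> (w n) = \<alpha> ^ num n *\<^sub>R M n" for n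
    by (subst word_matrix_scale) (simp add: count_list_std_word)
  have ela: "exp (la n) = \<alpha> ^ num n * rho n" for n
    using pos rho_pos[of n] by (simp add: la_def exp_add exp_of_nat_mult)
  have upper: "la n \<le> real (den n) * ln (jsr \<alpha>)" if n: "n \<ge> 2" for n
  proof -
    have "W \<alpha> (w n) *v rv n = (\<alpha> ^ num n * rho n) *s rv n"
      unfolding Wa scaleR_matrix_vector_assoc[symmetric] rM[OF n] by (simp add: vec_eq_iff)
    moreover have "w n \<noteq> []" using length_std_word[of n] den_pos[of n] by auto
    ultimately have "exp (la n) \<le> jsr \<alpha> ^ den n"
      unfolding ela length_std_word[symmetric] using \<alpha>(1) rv[OF n] rho_pos[of n]
      by (intro eigenvalue_le_jsr) auto
    then have "ln (exp (la n)) \<le> ln (jsr \<alpha> ^ den n)" using jpos by (subst ln_le_cancel_iff) auto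
    then show ?thesis using jpos by (simp add: ln_realpow)
  qed
  \<comment> \<open>The slope of the left Perron vector is bounded by \<open>D\<close> for every
    \<open>n\<close>, so eigenvalue and entry sum differ at most by a factor independent of
    \<open>n\<close>.\<close>
  have lower: "ln (mat_sum (W \<alpha> (w n))) - ln (1 + exp D) \<le> la n" and msp: "0 < mat_sum (W \<alpha> (w n))" if n: "n \<ge> 2" for n
  proof -
    have "log_slope (lv n) = log_slope (lv n v* M n)" using lM[OF n] log_slope_scale[OF lv[OF n] rho_pos] by simp
    then have "\<bar>log_slope (lv n)\<bar> \<le> D" using D(2)[OF n lv[OF n]] by simp
    then have "mat_sum (M n) \<le> (1 + exp D) * rho n"
      by (intro spectral_radius_ge_mat_sum[OF pos_M[OF n] lv[OF n] lM[OF n]])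
    then have le: "mat_sum (W \<alpha> (w n)) \<le> (1 + exp D) * exp (la n)"
      unfolding ela Wa mat_sum_scaleR using pos by (simp add: mult.left_commute)
    have "0 < mat_sum (M n)" using pos_M[OF n] by (simp add: mat_sum_def pos_mat_def add_pos_pos)
    then show "0 < mat_sum (W \<alpha> (w n))" unfolding Wa mat_sum_scaleR using pos by simp
    then have "ln (mat_sum (W \<alpha> (w n))) \<le> ln ((1 + exp D) * exp (la n))"
      using le by (subst ln_le_cancel_iff) (auto intro!: mult_pos_pos add_pos_pos)
    then show "ln (mat_sum (W \<alpha> (w n))) - ln (1 + exp D) \<le> la n"
      by (simp add: ln_mult_pos add_pos_pos)
  qed
  have y0: "\<forall>\<^sub>F n in sequentially. 0 \<le> y n"
    using eventually_ge_at_top[of 2]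
  proof eventually_elim
    case (elim n)
    then show ?case using upper[of n] dpos[of n] by (simp add: y_def field_simps)
  qed
  have sub: "filterlim den at_top sequentially"
    by (rule filterlim_at_top_mono[OF filterlim_ident]) (simp add: den_ge)
  \<comment> \<open>At the lengths \<open>den n\<close> with \<open>n \<ge> 1\<close> the prefix of
    the characteristic word is \<open>w n\<close> itself.\<close>
  have "(\<lambda>n. root (den n) (mat_sum (W \<alpha> (map char_word [0..<den n])))) \<longlonglongrightarrow> jsr \<alpha>"
    using filterlim_compose[OF floor_word_extremal[OF \<alpha>(1)] sub] \<alpha>(2) by simp
  then have "(\<lambda>n. ln (root (den n) (mat_sum (W \<alpha> (map char_word [0..<den n]))))) \<longlonglongrightarrow> ln (jsr \<alpha>)"
    using jpos by (intro tendsto_ln) auto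
  moreover have "(\<lambda>n. ln (1 + exp D) / real (den n)) \<longlonglongrightarrow> 0"
    by (rule filterlim_compose[OF lim_const_over_n sub])
  ultimately have "(\<lambda>n. ln (jsr \<alpha>) - (ln (root (den n) (mat_sum (W \<alpha> (map char_word [0..<den n])))) - ln (1 + exp D) / real (den n)))
    \<longlonglongrightarrow> ln (jsr \<alpha>) - (ln (jsr \<alpha>) - 0)" by (intro tendsto_diff tendsto_const)
  then have y_upper: "(\<lambda>n. ln (jsr \<alpha>) - (ln (root (den n) (mat_sum (W \<alpha> (map char_word [0..<den n])))) - ln (1 + exp D) / real (den n))) \<longlonglongrightarrow> 0"
    by simp
  have y1: "\<forall>\<^sub>F n in sequentially. y n \<le> ln (jsr \<alpha>) - (ln (root (den n) (mat_sum (W \<alpha> (map char_word [0..<den n])))) - ln (1 + exp D) / real (den n))"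
    using eventually_ge_at_top[of 2]
  proof eventually_elim
    case (elim n)
    have "ln (root (den n) (mat_sum (W \<alpha> (w n)))) = ln (mat_sum (W \<alpha> (w n))) / real (den n)"
      using msp[OF elim] den_pos[of n] by (intro ln_root)
    moreover have "(ln (mat_sum (W \<alpha> (w n))) - ln (1 + exp D)) / real (den n) \<le> la n / real (den n)"
      using lower[OF elim] dpos[of n] by (intro divide_right_mono) auto
    ultimately show ?case unfolding y_def using map_char_word_den[of n] elim by (simp add: diff_divide_distrib)
  qed
  have "y \<longlonglongrightarrow> 0" by (rule tendsto_sandwich[OF y0 y1 tendsto_const y_upper])
  moreover note y0
  moreover have "y n - y (Suc n) = (- 1) ^ n * F n / (real (den n) * real (den (Suc n)))" for n
  proof -
    have "(- 1) ^ n * F n = ((- 1) ^ n * (- 1) ^ n) * (real (den n) * lrho (Suc n) - real (den (Suc n)) * lrho n) + (- 1) ^ n * ln \<alpha>"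
      by (simp add: F_def cross_term_def distrib_left mult.assoc)
    also have "(- 1) ^ n * (- 1) ^ n = (1::real)" by (simp flip: power_add)
    \<comment> \<open>The determinant identity absorbs the exponents \<open>num n\<close> of the
      weight, which is why \<open>ln \<alpha>\<close> enters \<open>F\<close> without a factor
      depending on \<open>n\<close>.\<close>
    also have "(- 1) ^ n * ln \<alpha> = (real (num (Suc n)) * real (den n) - real (num n) * real (den (Suc n))) * ln \<alpha>"
      by (simp only: cf_det_real)
    finally have "(- 1) ^ n * F n = real (den n) * la (Suc n) - real (den (Suc n)) * la n"
      by (simp add: la_def algebra_simps)
    then show ?thesis using dpos[of n] dpos[of "Suc n"]
      by (simp add: y_def field_simps)
  qed
  moreover note dpos
  moreover have "2 * real (den n) \<le> real (den (n + 2))" for n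
  proof -
    have "1 * den (n + 1) \<le> a (n + 2) * den (n + 1)" using a_pos[of "n + 2"] by (intro mult_right_mono) auto
    moreover have "den n \<le> den (n + 1)" using den_mono by simp
    ultimately have "2 * den n \<le> den (n + 2)" using den_rec[of n] by linarith
    then show ?thesis by linarith
  qed
  moreover have "F \<longlonglongrightarrow> L + ln \<alpha>" unfolding F_def by (intro tendsto_intros E)
  ultimately have "L + ln \<alpha> = 0" by (rule alternating_increments_limit)
  then have "ln \<alpha> = - L" by simp
  then show ?thesis using pos exp_ln by metis
qed

end

section \<open>From the integer-indexed data of the theorem to the recursions above\<close>

theorem theorem2p5:
  fixes A0 A1 :: "real^2^2" and r :: "real \<Rightarrow> real" and \<gamma> :: real
    and a p q :: "nat \<Rightarrow> nat" and s :: "int \<Rightarrow> word" and \<rho> :: "int \<Rightarrow> real"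
  assumes "technical_hypotheses A0 A1"
    and "sturmian_hypothesis A0 A1 r"
    and "0 < \<gamma>" "\<gamma> < 1" "\<gamma> \<notin> \<rat>"
    and "cont_frac_coefficients \<gamma> a"
    and "\<And>n. n \<ge> 1 \<Longrightarrow>
           0 < q n \<and> coprime (p n) (q n) \<and> real (p n) / real (q n) = cont_frac (map a [1..<n + 1])"
    and "q 0 = 1"
    and "s (- 1) = [True]" "s 0 = [False]"
    and "s 1 = word_power (s 0) (a 1 - 1) @ s (- 1)"
    and "\<And>n::nat. n \<ge> 1 \<Longrightarrow> s (int n + 1) = word_power (s (int n)) (a (n + 1)) @ s (int n - 1)"
    and "\<And>n::int. n \<ge> - 1 \<Longrightarrow> \<rho> n = spectral_radius (word_matrix A0 A1 1 (s n))"
  shows "\<exists>\<alpha> P. {t. 0 \<le> t \<and> r t = \<gamma>} = {\<alpha>} \<and>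
           (\<lambda>n. (\<rho> (int n) ^ q (n + 1) / \<rho> (int n + 1) ^ q n) powi ((- 1) ^ n)) \<longlonglongrightarrow> \<alpha> \<and>
           (\<lambda>N. \<Prod>n<N. (\<rho> (int n) ^ a (n + 1) * \<rho> (int n - 1) / \<rho> (int n + 1))
                          powi ((- 1) ^ n * int (q n))) \<longlonglongrightarrow> P \<and>
           \<alpha> = 1 / spectral_radius A1 * P"
proof -
  interpret sturmian_irrational A0 A1 r \<gamma> a using assms by unfold_locales
  have s: "s (int n) = w n" for n
  proof (induction n rule: induct_nat_012)
    case 0
    then show ?case using assms(10) by simp
  next
    case 1
    then show ?case using assms(9-11) by simp
  next
    case (ge2 n)
    have "s (int (Suc n) + 1) = word_power (w (Suc n)) (a (Suc n + 1)) @ s (int (Suc n) - 1)"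
      using assms(12)[of "Suc n"] ge2 by simp
    then show ?case using ge2 by (simp add: std_word.simps(3) add.commute)
  qed
  have \<rho>: "\<rho> (int n) = rho n" for n using assms(13)[of "int n"] s by simp
  have \<rho>_Suc: "\<rho> (int n + 1) = rho (Suc n)" for n using \<rho>[of "Suc n"] by (simp add: add.commute)
  have \<rho>_m1: "\<rho> (- 1) = spectral_radius A1"
    using assms(9,13) by (simp add: word_matrix_Cons word_matrix_Nil letter_matrix_def)
  have q: "q n = den n" for n
  proof (cases "n = 0")
    case False
    then show ?thesis
      using assms(7)[of n] den_pos[of n] cf_coprime[of a n] cont_frac_convergent[of n]
      by (intro fraction_den_unique[of "p n" "q n" "num n" "den n"]) auto
  qed (use assms(8) in simp)
  define R where "R = spectral_radius A1"
  have R: "0 < R" unfolding R_def using nonneg_A trace_A by (intro spectral_radius_pos) (auto simp: nonneg_mat_def)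
  obtain L where L: "cross_term \<longlonglongrightarrow> L" using convergent_cross_term by (auto simp: convergent_def)
  have exp_ln_rho: "rho n ^ k = exp (real k * lrho n)" for n k
    using rho_pos[of n] by (simp add: exp_of_nat_mult)
  have sign: "real_of_int ((- 1) ^ n) = (- 1) ^ n" for n by simp
  have quotient: "(\<rho> (int n) ^ q (n + 1) / \<rho> (int n + 1) ^ q n) powi ((- 1) ^ n) = exp (- cross_term n)" for n
  proof -
    have "\<rho> (int n) ^ q (n + 1) / \<rho> (int n + 1) ^ q n = exp (real (den (n + 1)) * lrho n - real (den n) * lrho (n + 1))"
      unfolding \<rho> \<rho>_Suc q exp_ln_rho by (simp add: exp_diff)
    then show ?thesis by (simp only: exp_power_int sign cross_term_def) (simp add: algebra_simps)
  qed
  define T where "T N = (\<Prod>n<N. (\<rho> (int n) ^ a (n + 1) * \<rho> (int n - 1) / \<rho> (int n + 1)) powi ((- 1) ^ n * int (q n)))" for N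
  \<comment> \<open>The factor at \<open>n = 0\<close> is the only one containing
    \<open>\<rho> (- 1)\<close>, the spectral radius of \<open>A1\<close>; hence the factor
    \<open>R\<close>. Every later factor is a power of some \<open>exp (- defect N)\<close>, so the
    product telescopes through \<open>cross_term_Suc\<close>.\<close>
  have T: "T (Suc N) = R * exp (- cross_term N)" for N
  proof (induction N)
    case 0
    have "T (Suc 0) = rho 0 ^ a 1 * R / rho 1"
      using \<rho>[of 0] \<rho>[of 1] by (simp add: T_def q \<rho>_m1 R_def)
    also have "\<dots> = R * exp (- cross_term 0)"
      using rho_pos[of 0] rho_pos[of 1] unfolding exp_ln_rho cross_term_def by (simp add: exp_diff)
    finally show ?case .
  next
    case (Suc N)
    have "\<rho> (int (Suc N)) ^ a (Suc N + 1) * \<rho> (int (Suc N) - 1) / \<rho> (int (Suc N) + 1) = exp (- defect N)"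
      unfolding \<rho>_Suc unfolding \<rho> exp_ln_rho defect_def
      using \<rho>[of N] rho_pos[of N] rho_pos[of "Suc (Suc N)"] by (simp add: exp_diff exp_add)
    then have "T (Suc (Suc N)) = T (Suc N) * exp (- defect N) powi ((- 1) ^ Suc N * int (q (Suc N)))"
      by (simp add: T_def)
    also have "\<dots> = T (Suc N) * exp (- (cross_term (Suc N) - cross_term N))"
      unfolding cross_term_Suc exp_power_int q by simp
    also have "\<dots> = R * exp (- cross_term (Suc N))"
      unfolding Suc by (simp flip: exp_add)
    finally show ?case .
  qed
  have lim: "(\<lambda>n. exp (- cross_term n)) \<longlonglongrightarrow> exp (- L)" by (intro tendsto_intros L)
  have "(\<lambda>N. T (Suc N)) \<longlonglongrightarrow> R * exp (- L)" unfolding T by (intro tendsto_intros lim)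
  then have limT: "T \<longlonglongrightarrow> R * exp (- L)" by (simp add: filterlim_sequentially_Suc)
  obtain \<alpha> where \<alpha>: "0 < \<alpha>" "r \<alpha> = \<gamma>" using ratio_surj gamma by blast
  then have "\<alpha> = exp (- L)" using ratio_unique[OF L, of \<alpha>] by simp
  then have "0 \<le> exp (- L) \<and> r (exp (- L)) = \<gamma>" using \<alpha> by simp
  then have "{t. 0 \<le> t \<and> r t = \<gamma>} = {exp (- L)}"
    using ratio_unique[OF L] by blast
  moreover have "exp (- L) = 1 / spectral_radius A1 * (R * exp (- L))" using R by (simp add: R_def)
  ultimately show ?thesis unfolding quotient using lim limT unfolding T_def by blast
qed

end
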